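(* Let $(K;S)$ be a topological dynamical system and $\mu\in\mathrm{C}(K)'$ an $S$-invariant probability measure. Then the canonical restriction maps $$\mathcal{K}(K;S)\to\mathcal{E}(K;S),\ R\mapsto R|_{\ell^1(K)},\qquad \mathcal{K}(K;S)\to\mathcal{J}(K,\mu;S),\ R\mapsto R|_{\mathrm{L}^1(K,\mu)},\qquad \mathcal{K}_{\mathrm{c}}(K;S)\to\mathcal{J}_{\mathrm{c}}(K,\mu;S),\ R\mapsto R|_{\mathrm{L}^1(K,\mu)}$$ are (well-defined) epimorphisms of right topological semigroups; moreover $\mathcal{K}(K;S)\subset\mathcal{K}_{\mathrm{c}}(K;S)$ and $\mathcal{J}(K,\mu;S)\subset\mathcal{J}_{\mathrm{c}}(K,\mu;S)$.
   Context: Compact spaces are Hausdorff; vector spaces are complex. A semigroup with a topology is semitopological if multiplication is separately continuous, and right topological if $s\mapsto st$ is continuous for each $t$. Homomorphisms of right topological semigroups are continuous multiplicative maps; epimorphisms are surjective homomorphisms. A topological dynamical system $(K;S)$ is a compact space $K$ with a semitopological semigroup $S$ acting on $K$ such that $S\times K\to K$, $(s,x)\mapsto sx$ is continuous. The Koopman operators are $T_sf(x)=f(sx)$ on $\mathrm{C}(K)$; $\mathcal{T}_S'=\{T_s'\mid s\in S\}$ on $\mathrm{C}(K)'$, identified with the regular Borel measures on $K$. $\ell^1(K)$ is identified with the discrete measures and, for an $S$-invariant probability measure $\mu$ (i.e. $T_s'\mu=\mu$ for all $s$), $\mathrm{L}^1(K,\mu)$ with the measures absolutely continuous with respect to $\mu$;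 both are $\mathcal{T}_S'$-invariant. For a pair $(X,Y)$ with a bilinear form separating $X$, $\sigma(X,Y)$ is the locally convex topology on $X$ given by the seminorms $x\mapsto|\langle x,y\rangle|$, $y\in Y$, and for an operator semigroup $\mathcal{S}$ of $\sigma(X,Y)$-continuous linear maps on $X$, $\mathcal{K}(\mathcal{S};X,Y)$ is the closure of $\mathcal{S}$ in $X^X$ (product topology of $\sigma(X,Y)$), with composition. Define (restricting operators to the indicated spaces): $\mathcal{K}(K;S)=\mathcal{K}(\mathcal{T}_S';\mathrm{C}(K)',\mathrm{C}(K))$ (Köhler semigroup), $\mathcal{K}_{\mathrm{c}}(K;S)=\mathcal{K}(\mathrm{co}\,\mathcal{T}_S';\mathrm{C}(K)',\mathrm{C}(K))$ (convex Köhler semigroup), $\mathcal{E}(K;S)=\mathcal{K}(\mathcal{T}_S';\ell^1(K),\mathrm{C}(K))$ (Ellis semigroup), $\mathcal{J}(K,\mu;S)=\mathcal{K}(\mathcal{T}_S';\mathrm{L}^1(K,\mu),\mathrm{C}(K))$ (Jacobs semigroup), $\mathcal{J}_{\mathrm{c}}(K,\mu;S)=\mathcal{K}(\mathrm{co}\,\mathcal{T}_S';\mathrm{L}^1(K,\mu),\mathrm{C}(K))$ (convex Jacobs semigroup). Here $\mathrm{co}$ denotes the convex hull. *)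

theory Defs
  imports "HOL-Analysis.Analysis"
begin

section \<open>Right topological semigroups\<close>

text \<open>A semigroup with a topology is a pair of an abstract topology, whose \<^const>\<open>topspace\<close> is the
  carrier, and a multiplication on that carrier.\<close>

definition right_topological_semigroup :: "'a topology \<Rightarrow> ('a \<Rightarrow> 'a \<Rightarrow> 'a) \<Rightarrow> bool" where
  "right_topological_semigroup T m \<longleftrightarrow>
     (\<forall>s\<in>topspace T. \<forall>t\<in>topspace T. m s t \<in> topspace T) \<and>
     (\<forall>r\<in>topspace T. \<forall>s\<in>topspace T. \<forall>t\<in>topspace T. m (m r s) t = m r (m s t)) \<and>
     (\<forall>t\<in>topspace T. continuous_map T T (\<lambda>s. m s t))"

definition rts_homomorphism ::
  "'a topology \<Rightarrow> ('a \<Rightarrow> 'a \<Rightarrow> 'a) \<Rightarrow> 'b topology \<Rightarrow> ('b \<Rightarrow> 'b \<Rightarrow> 'b) \<Rightarrow> ('a \<Rightarrow> 'b) \<Rightarrow> bool" where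
  "rts_homomorphism T m T' m' \<phi> \<longleftrightarrow>
     right_topological_semigroup T m \<and> right_topological_semigroup T' m' \<and>
     continuous_map T T' \<phi> \<and>
     (\<forall>s\<in>topspace T. \<forall>t\<in>topspace T. \<phi> (m s t) = m' (\<phi> s) (\<phi> t))"

definition rts_epimorphism ::
  "'a topology \<Rightarrow> ('a \<Rightarrow> 'a \<Rightarrow> 'a) \<Rightarrow> 'b topology \<Rightarrow> ('b \<Rightarrow> 'b \<Rightarrow> 'b) \<Rightarrow> ('a \<Rightarrow> 'b) \<Rightarrow> bool" where
  "rts_epimorphism T m T' m' \<phi> \<longleftrightarrow>
     rts_homomorphism T m T' m' \<phi> \<and> \<phi> ` topspace T = topspace T'"


section \<open>The closure of an operator semigroup for a pair of spaces\<close>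

definition weak_topology ::
  "'x::ab_group_add set \<Rightarrow> 'y set \<Rightarrow> ('x \<Rightarrow> 'y \<Rightarrow> complex) \<Rightarrow> 'x topology" where
  "weak_topology X Y b =
     topology_generated_by
       (insert X {{x \<in> X. cmod (b (x - x0) y) < e} |x0 y e. x0 \<in> X \<and> y \<in> Y \<and> (0::real) < e})"

text \<open>The space \<open>X\<^sup>X\<close> consists of the extensional self-maps of the carrier \<open>X\<close>.\<close>

definition self_map_topology ::
  "'x::ab_group_add set \<Rightarrow> 'y set \<Rightarrow> ('x \<Rightarrow> 'y \<Rightarrow> complex) \<Rightarrow> ('x \<Rightarrow> 'x) topology" where
  "self_map_topology X Y b = product_topology (\<lambda>_. weak_topology X Y b) X"

text \<open>The operators in \<open>\<S>\<close> may be defined beyond \<open>X\<close>; they are restricted to \<open>X\<close>, which they are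
  required to leave invariant.\<close>

definition operator_closure ::
  "('x::ab_group_add \<Rightarrow> 'x) set \<Rightarrow> 'x set \<Rightarrow> 'y set \<Rightarrow> ('x \<Rightarrow> 'y \<Rightarrow> complex) \<Rightarrow> ('x \<Rightarrow> 'x) set" where
  "operator_closure \<S> X Y b = self_map_topology X Y b closure_of ((\<lambda>R. restrict R X) ` \<S>)"


section \<open>Topological dynamical systems and Koopman operators\<close>

definition semitopological_semigroup :: "'s::{topological_space,semigroup_mult} itself \<Rightarrow> bool" where
  "semitopological_semigroup _ \<longleftrightarrow>
     (\<forall>t::'s. continuous_on UNIV (\<lambda>s. s * t)) \<and> (\<forall>s::'s. continuous_on UNIV (\<lambda>t. s * t))"

definition topological_dynamical_system ::
  "('s::{topological_space,semigroup_mult} \<Rightarrow> 'k::t2_space \<Rightarrow> 'k) \<Rightarrow> bool" where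
  "topological_dynamical_system act \<longleftrightarrow>
     compact (UNIV :: 'k set) \<and>
     semitopological_semigroup TYPE('s) \<and>
     (\<forall>s t x. act (s * t) x = act s (act t x)) \<and>
     continuous_on UNIV (\<lambda>(s, x). act s x)"

text \<open>For compact \<open>K\<close>, the type \<open>'k \<Rightarrow>\<^sub>C complex\<close> is \<open>C(K)\<close>. Its library structure is that of a real
  normed space, so the dual \<open>C(K)'\<close> is the set of complex-homogeneous elements among the
  real-linear bounded functionals.\<close>

type_synonym 'k functional = "('k \<Rightarrow>\<^sub>C complex) \<Rightarrow>\<^sub>L complex"

definition dual_C :: "'k::topological_space functional set" where
  "dual_C = {\<phi>. \<forall>c f g. (\<forall>x. apply_bcontfun g x = c * apply_bcontfun f x) \<longrightarrow>
                  blinfun_apply \<phi> g = c * blinfun_apply \<phi> f}"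

definition koopman ::
  "('s \<Rightarrow> 'k::topological_space \<Rightarrow> 'k) \<Rightarrow> 's \<Rightarrow> ('k \<Rightarrow>\<^sub>C complex) \<Rightarrow>\<^sub>L ('k \<Rightarrow>\<^sub>C complex)" where
  "koopman act s = Blinfun (\<lambda>f. Bcontfun (\<lambda>x. apply_bcontfun f (act s x)))"

definition koopman_dual ::
  "('s \<Rightarrow> 'k::topological_space \<Rightarrow> 'k) \<Rightarrow> 's \<Rightarrow> 'k functional \<Rightarrow>\<^sub>L 'k functional" where
  "koopman_dual act s = Blinfun (\<lambda>\<phi>. \<phi> o\<^sub>L koopman act s)"

lemma koopman_apply:
  fixes act :: "'s \<Rightarrow> 'k::topological_space \<Rightarrow> 'k"
  assumes "continuous_on UNIV (act s)"
  shows "apply_bcontfun (blinfun_apply (koopman act s) f) x = apply_bcontfun f (act s x)"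
proof -
  let ?c = "\<lambda>f :: 'k \<Rightarrow>\<^sub>C complex. \<lambda>x. apply_bcontfun f (act s x)"
  have "?c f \<in> bcontfun" for f
    by (rule bcontfun_normI[where b = "norm f"])
      (auto intro: norm_bounded continuous_on_compose2[OF continuous_on_apply_bcontfun assms])
  then have c: "apply_bcontfun (Bcontfun (?c f)) = ?c f" for f
    by (rule Bcontfun_inverse)
  have "bounded_linear (\<lambda>f. Bcontfun (?c f))"
  proof (rule bounded_linear_intro[where K = 1])
    show "Bcontfun (?c (f + g)) = Bcontfun (?c f) + Bcontfun (?c g)" for f g
      by (rule bcontfun_eqI) (simp only: c, simp only: c plus_bcontfun.rep_eq)
    show "Bcontfun (?c (r *\<^sub>R f)) = r *\<^sub>R Bcontfun (?c f)" for r f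
      by (rule bcontfun_eqI) (simp only: c, simp only: c scaleR_bcontfun.rep_eq)
    show "norm (Bcontfun (?c f)) \<le> norm f * 1" for f
      by (rule norm_bound) (simp add: c norm_bounded)
  qed
  then show ?thesis
    by (simp add: koopman_def bounded_linear_Blinfun_apply c)
qed

lemma koopman_dual_apply:
  "blinfun_apply (koopman_dual act s) \<phi> = \<phi> o\<^sub>L koopman act s"
  unfolding koopman_dual_def
  by (simp add: bounded_linear_Blinfun_apply
      bounded_bilinear.bounded_linear_left[OF bounded_bilinear_blinfun_compose])

lemma continuous_on_act:
  assumes "topological_dynamical_system act"
  shows "continuous_on UNIV (act s)"
proof -
  have "continuous_on UNIV (\<lambda>(s, x). act s x)"
    using assms by (simp add: topological_dynamical_system_def)
  from continuous_on_compose2[OF this, of UNIV "\<lambda>x. (s, x)"]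
  show ?thesis by (simp add: continuous_on_Pair)
qed


section \<open>Measures as functionals\<close>

definition regular_borel_probability :: "'k::topological_space measure \<Rightarrow> bool" where
  "regular_borel_probability M \<longleftrightarrow>
     sets M = sets borel \<and> emeasure M (space M) = 1 \<and>
     (\<forall>A\<in>sets M.
        emeasure M A = (SUP C\<in>{C. compact C \<and> C \<in> sets M \<and> C \<subseteq> A}. emeasure M C) \<and>
        emeasure M A = (INF U\<in>{U. open U \<and> A \<subseteq> U}. emeasure M U))"

definition functional_of_measure :: "'k::topological_space measure \<Rightarrow> 'k functional" where
  "functional_of_measure M = Blinfun (\<lambda>f. LINT x|M. apply_bcontfun f x)"

lemma functional_of_measure_apply:
  fixes M :: "'k::topological_space measure"
  assumes M: "regular_borel_probability M"
  shows "blinfun_apply (functional_of_measure M) f = (LINT x|M. apply_bcontfun f x)"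
proof -
  have sets: "sets M = sets borel" and one: "emeasure M (space M) = 1"
    using M by (auto simp: regular_borel_probability_def)
  have fin: "finite_measure M" by (rule finite_measureI) (simp add: one)
  have meas: "apply_bcontfun g \<in> borel_measurable M" for g :: "'k \<Rightarrow>\<^sub>C complex"
    using borel_measurable_continuous_onI[of "apply_bcontfun g"] measurable_cong_sets[OF sets refl]
    by blast
  have int: "integrable M (apply_bcontfun g)" for g :: "'k \<Rightarrow>\<^sub>C complex"
    by (rule finite_measure.integrable_const_bound[OF fin, where B = "norm g"])
      (auto intro: norm_bounded meas)
  have "cmod (LINT x|M. apply_bcontfun g x) \<le> norm g * 1" for g :: "'k \<Rightarrow>\<^sub>C complex"
  proof -
    have "cmod (LINT x|M. apply_bcontfun g x) \<le> (LINT x|M. cmod (apply_bcontfun g x))"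
      by (rule integral_norm_bound)
    also have "\<dots> \<le> (LINT x|M. norm g)"
      by (rule integral_mono)
        (auto simp: norm_bounded int intro!: integrable_norm finite_measure.integrable_const[OF fin])
    finally show ?thesis by (simp add: measure_def one)
  qed
  then have "bounded_linear (\<lambda>g :: 'k \<Rightarrow>\<^sub>C complex. LINT x|M. apply_bcontfun g x)"
    by (intro bounded_linear_intro[where K = 1]) (auto simp: int plus_bcontfun.rep_eq)
  then show ?thesis by (simp add: functional_of_measure_def bounded_linear_Blinfun_apply)
qed

definition invariant_measure ::
  "('s \<Rightarrow> 'k::topological_space \<Rightarrow> 'k) \<Rightarrow> 'k measure \<Rightarrow> bool" where
  "invariant_measure act M \<longleftrightarrow>
     (\<forall>s. blinfun_apply (koopman_dual act s) (functional_of_measure M) = functional_of_measure M)"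

text \<open>The discrete measure with weights \<open>a\<close> is the functional \<open>f \<mapsto> \<Sum>\<^sub>x a(x) f(x)\<close>.\<close>

definition l1_space :: "'k::topological_space functional set" where
  "l1_space = {\<phi>\<in>dual_C. \<exists>a :: 'k \<Rightarrow> complex. (\<lambda>x. cmod (a x)) summable_on UNIV \<and>
      (\<forall>f. blinfun_apply \<phi> f = (\<Sum>\<^sub>\<infinity>x. a x * apply_bcontfun f x))}"

text \<open>A function \<open>h\<close> in \<open>L\<^sup>1(K,M)\<close> is identified with the absolutely continuous measure with
  density \<open>h\<close>, that is, with the functional \<open>f \<mapsto> \<integral> h f dM\<close>.\<close>

definition L1_space :: "'k::topological_space measure \<Rightarrow> 'k functional set" where
  "L1_space M = {\<phi>\<in>dual_C. \<exists>h :: 'k \<Rightarrow> complex. integrable M h \<and>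
      (\<forall>f. blinfun_apply \<phi> f = (LINT x|M. h x * apply_bcontfun f x))}"


section \<open>Enveloping semigroups\<close>

text \<open>In each case \<open>Y = C(K)\<close> and the pairing is evaluation of functionals. The convex hull is taken
  in the vector space of bounded operators; as restriction is linear, restricting its elements
  gives the convex hull of the restricted operators.\<close>

abbreviation koopman_semigroup ::
  "('s \<Rightarrow> 'k::topological_space \<Rightarrow> 'k) \<Rightarrow> ('k functional \<Rightarrow> 'k functional) set" where
  "koopman_semigroup act \<equiv> blinfun_apply ` range (koopman_dual act)"

abbreviation convex_koopman_semigroup ::
  "('s \<Rightarrow> 'k::topological_space \<Rightarrow> 'k) \<Rightarrow> ('k functional \<Rightarrow> 'k functional) set" where
  "convex_koopman_semigroup act \<equiv> blinfun_apply ` (convex hull (range (koopman_dual act)))"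

definition koehler_semigroup ::
  "('s \<Rightarrow> 'k::topological_space \<Rightarrow> 'k) \<Rightarrow> ('k functional \<Rightarrow> 'k functional) set" where
  "koehler_semigroup act = operator_closure (koopman_semigroup act) dual_C UNIV blinfun_apply"

definition convex_koehler_semigroup ::
  "('s \<Rightarrow> 'k::topological_space \<Rightarrow> 'k) \<Rightarrow> ('k functional \<Rightarrow> 'k functional) set" where
  "convex_koehler_semigroup act =
     operator_closure (convex_koopman_semigroup act) dual_C UNIV blinfun_apply"

definition ellis_semigroup ::
  "('s \<Rightarrow> 'k::topological_space \<Rightarrow> 'k) \<Rightarrow> ('k functional \<Rightarrow> 'k functional) set" where
  "ellis_semigroup act = operator_closure (koopman_semigroup act) l1_space UNIV blinfun_apply"

definition jacobs_semigroup ::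
  "('s \<Rightarrow> 'k::topological_space \<Rightarrow> 'k) \<Rightarrow> 'k measure \<Rightarrow> ('k functional \<Rightarrow> 'k functional) set" where
  "jacobs_semigroup act M =
     operator_closure (koopman_semigroup act) (L1_space M) UNIV blinfun_apply"

definition convex_jacobs_semigroup ::
  "('s \<Rightarrow> 'k::topological_space \<Rightarrow> 'k) \<Rightarrow> 'k measure \<Rightarrow> ('k functional \<Rightarrow> 'k functional) set" where
  "convex_jacobs_semigroup act M =
     operator_closure (convex_koopman_semigroup act) (L1_space M) UNIV blinfun_apply"

text \<open>The topology of a semigroup \<open>\<R>\<close> of self-maps of \<open>X\<close>; its multiplication is \<open>compose X\<close>.\<close>

definition operator_topology ::
  "'k::topological_space functional set \<Rightarrow> ('k functional \<Rightarrow> 'k functional) set \<Rightarrow>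
     ('k functional \<Rightarrow> 'k functional) topology" where
  "operator_topology X \<R> = subtopology (self_map_topology X UNIV blinfun_apply) \<R>"

end

theory Submission
  imports Defs
begin

text \<open>Restriction to an invariant subspace \<open>X\<close> of \<open>C(K)'\<close> is a continuous multiplicative map from
self-maps of \<open>C(K)'\<close> to self-maps of \<open>X\<close>, and it carries each generator to its restriction. By
Banach--Alaoglu and Tychonoff the closure \<open>\<K>\<close> of a semigroup of contractions with pre-adjoints on
\<open>C(K)'\<close> is compact, so its image under restriction is compact, hence closed in the Hausdorff space
\<open>X\<^sup>X\<close>. The image therefore contains the closure of the restricted generators, and by continuity
it is contained in it. This gives surjectivity and the epimorphism for every \<open>X\<close> that is
invariant under all of \<open>\<K>\<close> (\<open>rts_epimorphism_restrict\<close>). What remains is this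
invariance, which does not follow from the invariance under the generators, since in
general neither \<open>L\<^sup>1(K,\<mu>)\<close> nor \<open>\<ell>\<^sup>1(K)\<close> is weak* closed.

For \<open>L\<^sup>1(K,\<mu>)\<close>: because \<open>\<mu>\<close> is invariant, the Koopman operators, and with them their convex
combinations, are contractions both for the supremum norm and for the norm of \<open>L\<^sup>1(K,\<mu>)\<close>. Hence a
bound \<open>\<bar>\<psi>(f)\<bar> \<le> c \<integral> \<bar>f\<bar> d\<mu>\<close>, being a closed condition, passes from \<open>\<psi>\<close> to \<open>R \<psi>\<close> for every \<open>R\<close>
in the closure. The functionals that satisfy such a bound are the measures with bounded density
(\<open>bounded_density\<close>, by Radon--Nikodym), and \<open>L\<^sup>1(K,\<mu>)\<close> consists exactly of their norm limits in
\<open>C(K)'\<close> (\<open>approx_imp_L1_space\<close>, \<open>L1_space_imp_approx\<close>). As \<open>R\<close> does not increase norm distances,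
\<open>L\<^sup>1(K,\<mu>)\<close> is preserved.

For \<open>\<ell>\<^sup>1(K)\<close>: the point evaluations form a weak* compact set that the generators preserve, so
\<open>R \<delta>\<^sub>x = \<delta>\<^bsub>\<theta>(x)\<^esub>\<close> for a (possibly discontinuous) map \<open>\<theta>\<close>, and a uniform tail estimate shows that \<open>R\<close>
maps \<open>\<Sum>\<^sub>x a(x) \<delta>\<^sub>x\<close> to \<open>\<Sum>\<^sub>x a(x) \<delta>\<^bsub>\<theta>(x)\<^esub>\<close> (\<open>operator_closure_l1_space\<close>).\<close>

section \<open>Continuous functions are dense in \<open>L\<^sup>1\<close>\<close>

lemma apply_bcontfun_plus [simp]: "apply_bcontfun (f + g) x = apply_bcontfun f x + apply_bcontfun g x"
  by (simp add: plus_bcontfun.rep_eq)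

lemma apply_bcontfun_minus [simp]: "apply_bcontfun (f - g) x = apply_bcontfun f x - apply_bcontfun g x"
  by (simp add: minus_bcontfun.rep_eq)

text \<open>The type of bounded continuous functions carries only a real scalar multiplication; complex
multiples are needed to use the complex homogeneity of functionals in \<^const>\<open>dual_C\<close>.\<close>

definition cscale :: "complex \<Rightarrow> ('k::topological_space \<Rightarrow>\<^sub>C complex) \<Rightarrow> ('k \<Rightarrow>\<^sub>C complex)" where
  "cscale c f = Bcontfun (\<lambda>x. c * apply_bcontfun f x)"

lemma apply_cscale [simp]: "apply_bcontfun (cscale c f) x = c * apply_bcontfun f x"
proof -
  have "(\<lambda>x. c * apply_bcontfun f x) \<in> bcontfun"
    by (rule bcontfun_normI[where b = "cmod c * norm f"])
      (auto intro!: continuous_intros mult_left_mono norm_bounded simp: norm_mult)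
  then show ?thesis by (simp add: cscale_def Bcontfun_inverse)
qed

lemma dual_C_cscale: "\<phi> \<in> dual_C \<Longrightarrow> blinfun_apply \<phi> (cscale c f) = c * blinfun_apply \<phi> f"
  by (simp add: dual_C_def)

lemma dual_C_diff: "\<phi> \<in> dual_C \<Longrightarrow> \<psi> \<in> dual_C \<Longrightarrow> \<phi> - \<psi> \<in> dual_C"
  unfolding dual_C_def
  by (intro CollectI allI impI, simp only: mem_Collect_eq blinfun.diff_left right_diff_distrib) metis

locale compact_regular_probability =
  fixes M :: "'k::t2_space measure"
  assumes regular: "regular_borel_probability M"
    and compact_UNIV: "compact (UNIV :: 'k set)"
begin

lemma sets_eq: "sets M = sets borel" and space_eq: "space M = UNIV"
  and emeasure_space_1: "emeasure M (space M) = 1"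
  using regular sets_eq_imp_space_eq[of M borel] by (auto simp: regular_borel_probability_def)

sublocale finite_measure M
  by (rule finite_measureI) (simp add: emeasure_space_1)

lemma measurable_apply_bcontfun [measurable]:
  "apply_bcontfun (f :: 'k \<Rightarrow>\<^sub>C complex) \<in> borel_measurable M"
  using borel_measurable_continuous_onI[of "apply_bcontfun f"] measurable_cong_sets[OF sets_eq refl]
  by blast

lemma integrable_apply_bcontfun [simp]: "integrable M (apply_bcontfun (f :: 'k \<Rightarrow>\<^sub>C complex))"
  by (rule integrable_const_bound[where B = "norm f"]) (auto intro: norm_bounded)

lemma integrable_mult_bcontfun:
  fixes h :: "'k \<Rightarrow> complex"
  assumes "integrable M h"
  shows "integrable M (\<lambda>x. h x * apply_bcontfun f x)"
proof (rule Bochner_Integration.integrable_bound)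
  show "integrable M (\<lambda>x. cmod (h x) * norm f)" using assms by simp
  show "AE x in M. cmod (h x * apply_bcontfun f x) \<le> norm (cmod (h x) * norm f)"
    by (auto simp: norm_mult intro!: mult_left_mono norm_bounded)
qed (use assms in measurable)

text \<open>Urysohn's function between a compact set inside \<open>A\<close> and the complement of an open set around \<open>A\<close>
differs from the indicator of \<open>A\<close> only on the difference of the two sets, which regularity makes
small. The condition \<open>\<bar>2 f - 1\<bar> \<le> 1\<close>, which holds as \<open>f\<close> has values in \<open>[0, 1]\<close>, says that the
approximants \<open>2 f - 1\<close> of the sign function of \<open>A\<close> have supremum norm at most one.\<close>

lemma indicator_approx:
  assumes A: "A \<in> sets M" and e: "e > 0"
  shows "\<exists>f :: 'k \<Rightarrow>\<^sub>C complex. (\<forall>x. cmod (2 * apply_bcontfun f x - 1) \<le> 1) \<and>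
           (LINT x|M. cmod (indicator A x - apply_bcontfun f x)) < e"
proof -
  have inner: "emeasure M A = (SUP C\<in>{C. compact C \<and> C \<in> sets M \<and> C \<subseteq> A}. emeasure M C)"
    and outer: "emeasure M A = (INF U\<in>{U. open U \<and> A \<subseteq> U}. emeasure M U)"
    using regular A unfolding regular_borel_probability_def by blast+
  have "\<exists>C. compact C \<and> C \<in> sets M \<and> C \<subseteq> A \<and> measure M A - e/2 < measure M C"
  proof (cases "measure M A - e/2 < 0")
    case True
    then show ?thesis by (intro exI[of _ "{}"]) auto
  next
    case False
    then have "ennreal (measure M A - e/2) < emeasure M A"
      using e by (simp add: emeasure_eq_measure ennreal_less_iff)
    then obtain C where "compact C" "C \<in> sets M" "C \<subseteq> A" "ennreal (measure M A - e/2) < emeasure M C"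
      unfolding inner less_SUP_iff by auto
    then show ?thesis using False by (auto simp: emeasure_eq_measure ennreal_less_iff)
  qed
  then obtain C where C: "compact C" "C \<in> sets M" "C \<subseteq> A" "measure M A - e/2 < measure M C"
    by blast
  have "emeasure M A < ennreal (measure M A + e/2)"
    using e by (simp add: emeasure_eq_measure ennreal_less_iff)
  then obtain U where U: "open U" "A \<subseteq> U" "emeasure M U < ennreal (measure M A + e/2)"
    unfolding outer Inf_less_iff INF_less_iff by auto
  have Us: "U \<in> sets M" using U(1) by (simp add: sets_eq)
  have mU: "measure M U < measure M A + e/2"
    using U(3) by (simp add: emeasure_eq_measure ennreal_less_iff)
  have nrm: "normal_space (euclidean :: 'k topology)"
    by (rule compact_Hausdorff_or_regular_imp_normal_space)
      (use compact_UNIV in \<open>auto simp: compact_space_def Hausdorff_space_def disjnt_def separation_t2\<close>)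
  have cl: "closedin euclidean C" "closedin euclidean (- U)" "disjnt (- U) C"
    using C U by (auto simp: compact_imp_closed disjnt_def closed_Compl)
  obtain g where g: "continuous_map (euclidean :: 'k topology) (top_of_set {0..1::real}) g"
      "g ` (- U) \<subseteq> {0}" "g ` C \<subseteq> {1}"
    using Urysohn_lemma[OF nrm cl(2,1,3), of 0 1] by auto
  have gc: "continuous_on UNIV g" and g01: "0 \<le> g x" "g x \<le> 1" for x
    using g(1) by (auto simp: continuous_map_in_subtopology)
  have "(\<lambda>x. complex_of_real (g x)) \<in> bcontfun"
    by (rule bcontfun_normI[where b = 1]) (use g01 gc in \<open>auto intro!: continuous_intros\<close>)
  then have ap: "apply_bcontfun (Bcontfun (\<lambda>x. complex_of_real (g x))) x = g x" for x
    by (simp add: Bcontfun_inverse)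
  let ?f = "Bcontfun (\<lambda>x. complex_of_real (g x))"
  have diff: "cmod (indicator A x - apply_bcontfun ?f x) \<le> indicator (U - C) x" for x
  proof -
    have "cmod (indicator A x - apply_bcontfun ?f x) = \<bar>indicator A x - g x\<bar>"
      unfolding ap by (metis norm_of_real of_real_diff of_real_indicator)
    also have "\<dots> \<le> indicator (U - C) x"
      using g(2,3) C(3) U(2) g01[of x] by (auto simp: indicator_def)
    finally show ?thesis .
  qed
  have "complex_integrable M (indicator A)"
    using A by (intro integrable_const_bound[where B = 1]) (auto simp: indicator_def)
  moreover have "integrable M (indicat_real (U - C))"
    using C(2) Us by (intro integrable_const_bound[where B = 1]) (auto simp: indicator_def)
  ultimately have "(LINT x|M. cmod (indicator A x - apply_bcontfun ?f x)) \<le> (LINT x|M. indicator (U - C) x)"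
    by (intro integral_mono[OF _ _ diff]) auto
  also have "\<dots> = measure M U - measure M C"
    using C Us U by (simp add: finite_measure_Diff space_eq)
  also have "\<dots> < e" using C(4) mU by simp
  finally have 1: "(LINT x|M. cmod (indicator A x - apply_bcontfun ?f x)) < e" .
  have "cmod (2 * apply_bcontfun ?f x - 1) = \<bar>2 * g x - 1\<bar>" for x
    unfolding ap by (metis norm_of_real of_real_1 of_real_diff of_real_mult of_real_numeral)
  then have "cmod (2 * apply_bcontfun ?f x - 1) \<le> 1" for x using g01[of x] by simp
  with 1 show ?thesis by blast
qed

lemma L1_dense:
  fixes u :: "'k \<Rightarrow> complex"
  assumes "integrable M u" and "e > 0"
  shows "\<exists>f. (LINT x|M. cmod (u x - apply_bcontfun f x)) < e"
  using assms
proof (induction arbitrary: e rule: integrable_induct)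
  case (base A c)
  \<comment> \<open>The summand 1 covers the case that \<open>c\<close> is 0.\<close>
  have "e / (cmod c + 1) > 0" using base by (simp add: add_nonneg_pos)
  then obtain f :: "'k \<Rightarrow>\<^sub>C complex" 
    where f: "(LINT x|M. cmod (indicator A x - apply_bcontfun f x)) < e / (cmod c + 1)"
    using indicator_approx[OF base(1)] by blast
  have "cmod (indicator A x *\<^sub>R c - apply_bcontfun (cscale c f) x)
      = cmod c * cmod (indicator A x - apply_bcontfun f x)" for x
    by (simp add: norm_mult[symmetric] algebra_simps scaleR_conv_of_real of_real_indicator)
  then have "(LINT x|M. cmod (indicator A x *\<^sub>R c - apply_bcontfun (cscale c f) x))
      = cmod c * (LINT x|M. cmod (indicator A x - apply_bcontfun f x))" by simp
  also have "\<dots> \<le> (cmod c + 1) * (LINT x|M. cmod (indicator A x - apply_bcontfun f x))"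
    by (intro mult_right_mono) auto
  also have "\<dots> < e" using f by (simp add: pos_less_divide_eq add_nonneg_pos mult.commute)
  finally show ?case by blast
next
  case (add u v)
  from add.IH(1)[of "e/2"] add.IH(2)[of "e/2"] \<open>e > 0\<close> obtain f g where
    fg: "(LINT x|M. cmod (u x - apply_bcontfun f x)) < e/2"
      "(LINT x|M. cmod (v x - apply_bcontfun g x)) < e/2" by auto
  have "(LINT x|M. cmod (u x + v x - apply_bcontfun (f + g) x)) 
     \<le> (LINT x|M. cmod (u x - apply_bcontfun f x) + cmod (v x - apply_bcontfun g x))"
    using add by (intro integral_mono)
      (auto intro!: integrable_norm Bochner_Integration.integrable_add Bochner_Integration.integrable_diff
       simp: add_diff_add norm_triangle_ineq)
  also have "\<dots> < e" using add fg by (subst Bochner_Integration.integral_add) auto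
  finally show ?case by blast
next
  case (lim u s)
  have "(\<lambda>i. LINT x|M. cmod (u x - s i x)) \<longlonglongrightarrow> (LINT x|M. 0)"
  proof (rule integral_dominated_convergence[where w = "\<lambda>x. 3 * cmod (u x)"])
    show "AE x in M. (\<lambda>i. cmod (u x - s i x)) \<longlonglongrightarrow> 0"
    proof (rule AE_I2)
      fix x assume "x \<in> space M"
      from tendsto_norm[OF tendsto_diff[OF tendsto_const[of "u x"] lim.hyps(2)[OF this]]]
      show "(\<lambda>i. cmod (u x - s i x)) \<longlonglongrightarrow> 0" by simp
    qed
    show "AE x in M. norm (cmod (u x - s i x)) \<le> 3 * cmod (u x)" for i
      using lim.hyps(3) by (intro AE_I2) (smt (verit) norm_triangle_ineq4 real_norm_def norm_ge_zero)
  qed (use lim in auto)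
  then have "\<forall>\<^sub>F i in sequentially. (LINT x|M. cmod (u x - s i x)) < e/2"
    by (rule order_tendstoD) (use lim.prems in auto)
  then obtain i where i: "(LINT x|M. cmod (u x - s i x)) < e/2"
    by (auto simp: eventually_sequentially)
  obtain f where f: "(LINT x|M. cmod (s i x - apply_bcontfun f x)) < e/2"
    using lim.IH[of "e/2"] lim.prems by auto
  have "(LINT x|M. cmod (u x - apply_bcontfun f x)) 
     \<le> (LINT x|M. cmod (u x - s i x) + cmod (s i x - apply_bcontfun f x))"
    using lim by (intro integral_mono)
      (auto intro!: integrable_norm Bochner_Integration.integrable_add Bochner_Integration.integrable_diff
       norm_diff_triangle_ineq norm_diff_triangle_le)
  also have "\<dots> < e" using lim i f by (subst Bochner_Integration.integral_add) auto
  finally show ?case by blast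
qed

section \<open>Functionals with bounded density\<close>

text \<open>A functional that is bounded for the norm of \<open>L\<^sup>1(M)\<close> extends from the dense subspace of continuous
functions by continuity. The extension \<open>\<Phi>\<close> acts on functions, so that it can be evaluated
at indicators of Borel sets.\<close>

lemma bounded_extension:
  fixes \<phi> :: "'k functional"
  assumes \<phi>: "\<phi> \<in> dual_C"
    and bound: "\<And>f. cmod (blinfun_apply \<phi> f) \<le> c * (LINT x|M. cmod (apply_bcontfun f x))"
    and c: "0 \<le> c"
  shows "\<exists>\<Phi> :: ('k \<Rightarrow> complex) \<Rightarrow> complex.
     (\<forall>u v. integrable M u \<longrightarrow> integrable M v \<longrightarrow> \<Phi> (\<lambda>x. u x + v x) = \<Phi> u + \<Phi> v) \<and>
     (\<forall>u a. integrable M u \<longrightarrow> \<Phi> (\<lambda>x. a * u x) = a * \<Phi> u) \<and>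
     (\<forall>u. integrable M u \<longrightarrow> cmod (\<Phi> u) \<le> c * (LINT x|M. cmod (u x))) \<and>
     (\<forall>f. \<Phi> (apply_bcontfun f) = blinfun_apply \<phi> f)"
proof -
  define conv where "conv u f \<longleftrightarrow> (\<lambda>n. LINT x|M. cmod (u x - apply_bcontfun (f n) x)) \<longlonglongrightarrow> 0"
    for u :: "'k \<Rightarrow> complex" and f :: "nat \<Rightarrow> 'k \<Rightarrow>\<^sub>C complex"
  have ex: "\<exists>f. conv u f" if u: "integrable M u" for u
  proof -
    have "\<forall>n. \<exists>f. (LINT x|M. cmod (u x - apply_bcontfun f x)) < inverse (real (Suc n))"
      by (intro allI L1_dense u) simp
    then obtain f where f: "\<And>n. (LINT x|M. cmod (u x - apply_bcontfun (f n) x)) < inverse (real (Suc n))"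
      by metis
    show ?thesis unfolding conv_def
      by (rule exI[of _ f], rule tendsto_sandwich[OF _ _ tendsto_const LIMSEQ_inverse_real_of_nat])
        (use f in \<open>auto intro!: always_eventually intro: less_imp_le\<close>)
  qed
  have dist: "cmod (blinfun_apply \<phi> f - blinfun_apply \<phi> g)
      \<le> c * ((LINT x|M. cmod (u x - apply_bcontfun f x)) + (LINT x|M. cmod (u x - apply_bcontfun g x)))"
    if u: "integrable M u" for u f g
  proof -
    have "cmod (blinfun_apply \<phi> f - blinfun_apply \<phi> g) \<le> c * (LINT x|M. cmod (apply_bcontfun (f - g) x))"
      using bound[of "f - g"] by (simp add: blinfun.diff_right)
    also have "(LINT x|M. cmod (apply_bcontfun (f - g) x))
        \<le> (LINT x|M. cmod (u x - apply_bcontfun f x) + cmod (u x - apply_bcontfun g x))"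
    proof (rule integral_mono)
      show "cmod (apply_bcontfun (f - g) x) \<le> cmod (u x - apply_bcontfun f x) + cmod (u x - apply_bcontfun g x)" for x
        by (simp, metis norm_diff_triangle_ineq norm_minus_commute diff_add_cancel norm_triangle_sub 
              norm_diff_triangle_le order_refl)
      show "integrable M (\<lambda>x. cmod (apply_bcontfun (f - g) x))" by (intro integrable_norm) simp
    qed (use u in auto)
    also have "\<dots> = (LINT x|M. cmod (u x - apply_bcontfun f x)) + (LINT x|M. cmod (u x - apply_bcontfun g x))"
      using u by simp
    finally show ?thesis using c by (simp add: mult_left_mono)
  qed
  define sq where "sq u = (SOME f. conv u f)" for u
  have sq: "conv u (sq u)" if "integrable M u" for u
    unfolding sq_def using someI_ex[OF ex[OF that]] .
  define \<Phi> where "\<Phi> u = lim (\<lambda>n. blinfun_apply \<phi> (sq u n))" for u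
  have Cauchy: "Cauchy (\<lambda>n. blinfun_apply \<phi> (f n))" if u: "integrable M u" and f: "conv u f" for u f
  proof (rule metric_CauchyI)
    fix e :: real assume e: "e > 0"
    have "(\<lambda>n. c * (LINT x|M. cmod (u x - apply_bcontfun (f n) x))) \<longlonglongrightarrow> c * 0"
      using f unfolding conv_def by (intro tendsto_intros)
    then have "\<forall>\<^sub>F n in sequentially. c * (LINT x|M. cmod (u x - apply_bcontfun (f n) x)) < e/2"
      by (rule order_tendstoD) (use e in auto)
    then obtain N where N: "\<And>n. n \<ge> N \<Longrightarrow> c * (LINT x|M. cmod (u x - apply_bcontfun (f n) x)) < e/2"
      by (auto simp: eventually_sequentially)
    show "\<exists>N. \<forall>m\<ge>N. \<forall>n\<ge>N. dist (blinfun_apply \<phi> (f m)) (blinfun_apply \<phi> (f n)) < e"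
    proof (intro exI allI impI)
      fix m n assume "m \<ge> N" "n \<ge> N"
      then show "dist (blinfun_apply \<phi> (f m)) (blinfun_apply \<phi> (f n)) < e"
        using N[of m] N[of n] dist[OF u, of "f m" "f n"] by (simp add: dist_norm distrib_left)
    qed
  qed
  have lim: "(\<lambda>n. blinfun_apply \<phi> (f n)) \<longlonglongrightarrow> \<Phi> u" if u: "integrable M u" and f: "conv u f" for u f
  proof -
    have 1: "(\<lambda>n. blinfun_apply \<phi> (sq u n)) \<longlonglongrightarrow> \<Phi> u"
      using Cauchy[OF u sq[OF u]] unfolding \<Phi>_def by (simp add: Cauchy_convergent_iff convergent_LIMSEQ_iff)
    have "(\<lambda>n. c * ((LINT x|M. cmod (u x - apply_bcontfun (f n) x))
              + (LINT x|M. cmod (u x - apply_bcontfun (sq u n) x)))) \<longlonglongrightarrow> c * (0 + 0)"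
      using f sq[OF u] unfolding conv_def by (intro tendsto_intros)
    then have "(\<lambda>n. blinfun_apply \<phi> (f n) - blinfun_apply \<phi> (sq u n)) \<longlonglongrightarrow> 0"
      by (intro Lim_null_comparison[OF always_eventually[OF allI[OF dist[OF u]]]]) simp
    from tendsto_add[OF this 1] show ?thesis by simp
  qed
  have add: "\<Phi> (\<lambda>x. u x + v x) = \<Phi> u + \<Phi> v" if u: "integrable M u" and v: "integrable M v" for u v
  proof -
    have "conv (\<lambda>x. u x + v x) (\<lambda>n. sq u n + sq v n)" unfolding conv_def
    proof (rule tendsto_sandwich[OF _ _ tendsto_const])
      show "(\<lambda>n. (LINT x|M. cmod (u x - apply_bcontfun (sq u n) x))
              + (LINT x|M. cmod (v x - apply_bcontfun (sq v n) x))) \<longlonglongrightarrow> 0"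
        using tendsto_add[OF sq[OF u, unfolded conv_def] sq[OF v, unfolded conv_def]] by simp
      have "(LINT x|M. cmod (u x + v x - apply_bcontfun (f + g) x))
         \<le> (LINT x|M. cmod (u x - apply_bcontfun f x)) + (LINT x|M. cmod (v x - apply_bcontfun g x))" for f g
      proof -
        have "(LINT x|M. cmod (u x + v x - apply_bcontfun (f + g) x)) 
           \<le> (LINT x|M. cmod (u x - apply_bcontfun f x) + cmod (v x - apply_bcontfun g x))"
          using u v by (intro integral_mono)
            (auto intro!: integrable_norm Bochner_Integration.integrable_add Bochner_Integration.integrable_diff
             simp: add_diff_add norm_triangle_ineq)
        then show ?thesis using u v by simp
      qed
      then show "\<forall>\<^sub>F n in sequentially. (LINT x|M. cmod (u x + v x - apply_bcontfun (sq u n + sq v n) x))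
         \<le> (LINT x|M. cmod (u x - apply_bcontfun (sq u n) x)) + (LINT x|M. cmod (v x - apply_bcontfun (sq v n) x))"
        by simp
    qed (auto intro!: always_eventually)
    from lim[OF _ this] u v 
    have "(\<lambda>n. blinfun_apply \<phi> (sq u n) + blinfun_apply \<phi> (sq v n)) \<longlonglongrightarrow> \<Phi> (\<lambda>x. u x + v x)"
      by (simp add: blinfun.add_right)
    moreover have "(\<lambda>n. blinfun_apply \<phi> (sq u n) + blinfun_apply \<phi> (sq v n)) \<longlonglongrightarrow> \<Phi> u + \<Phi> v"
      by (intro tendsto_add lim u v sq)
    ultimately show ?thesis using LIMSEQ_unique by blast
  qed
  have scale: "\<Phi> (\<lambda>x. a * u x) = a * \<Phi> u" if u: "integrable M u" for u a
  proof -
    have "cmod (a * u x - apply_bcontfun (cscale a f) x) = cmod a * cmod (u x - apply_bcontfun f x)" for f x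
      by (simp add: norm_mult[symmetric] algebra_simps)
    then have "conv (\<lambda>x. a * u x) (\<lambda>n. cscale a (sq u n))"
      using tendsto_mult_left[OF sq[OF u, unfolded conv_def], of "cmod a"] unfolding conv_def by simp
    from lim[OF _ this] u have "(\<lambda>n. a * blinfun_apply \<phi> (sq u n)) \<longlonglongrightarrow> \<Phi> (\<lambda>x. a * u x)"
      by (simp add: dual_C_cscale[OF \<phi>])
    moreover have "(\<lambda>n. a * blinfun_apply \<phi> (sq u n)) \<longlonglongrightarrow> a * \<Phi> u"
      by (intro tendsto_intros lim u sq)
    ultimately show ?thesis using LIMSEQ_unique by blast
  qed
  have bnd: "cmod (\<Phi> u) \<le> c * (LINT x|M. cmod (u x))" if u: "integrable M u" for u
  proof -
    have "cmod (blinfun_apply \<phi> f) 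
        \<le> c * ((LINT x|M. cmod (u x)) + (LINT x|M. cmod (u x - apply_bcontfun f x)))" for f
    proof -
      have "(LINT x|M. cmod (apply_bcontfun f x)) 
          \<le> (LINT x|M. cmod (u x) + cmod (u x - apply_bcontfun f x))"
      proof (rule integral_mono)
        show "cmod (apply_bcontfun f x) \<le> cmod (u x) + cmod (u x - apply_bcontfun f x)" for x
          by (metis norm_minus_commute norm_triangle_sub)
      qed (use u in auto)
      then show ?thesis using bound[of f] c u
        by simp (meson mult_left_mono order_trans)
    qed
    moreover have "(\<lambda>n. c * ((LINT x|M. cmod (u x)) + (LINT x|M. cmod (u x - apply_bcontfun (sq u n) x))))
        \<longlonglongrightarrow> c * ((LINT x|M. cmod (u x)) + 0)"
      using sq[OF u] unfolding conv_def by (intro tendsto_intros)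
    ultimately have "cmod (\<Phi> u) \<le> c * ((LINT x|M. cmod (u x)) + 0)"
      by (intro LIMSEQ_le[OF tendsto_norm[OF lim[OF u sq[OF u]]]]) auto
    then show ?thesis by simp
  qed
  have "\<Phi> (apply_bcontfun f) = blinfun_apply \<phi> f" for f
  proof -
    have "(\<lambda>n. blinfun_apply \<phi> f) \<longlonglongrightarrow> \<Phi> (apply_bcontfun f)"
      by (rule lim) (auto simp: conv_def)
    then show ?thesis using LIMSEQ_unique tendsto_const by blast
  qed
  with add scale bnd show ?thesis by blast
qed

end

text \<open>Adding \<open>c\<close> times the measure makes \<open>\<nu>\<close> nonnegative, so that the Radon--Nikodym theorem for positive
measures applies; the domination by the measure also turns finite into countable additivity. The
averages of the resulting density lie in \<open>[- c, c]\<close>, hence so does the density almost everywhere,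
and truncation makes the bound hold everywhere.\<close>

lemma (in finite_measure) bounded_additive_density:
  fixes \<nu> :: "'a set \<Rightarrow> real"
  assumes add: "\<And>A B. A \<in> sets M \<Longrightarrow> B \<in> sets M \<Longrightarrow> A \<inter> B = {} \<Longrightarrow> \<nu> (A \<union> B) = \<nu> A + \<nu> B"
    and bound: "\<And>A. A \<in> sets M \<Longrightarrow> \<bar>\<nu> A\<bar> \<le> c * measure M A"
  shows "\<exists>g :: 'a \<Rightarrow> real. g \<in> borel_measurable M \<and> (\<forall>x. \<bar>g x\<bar> \<le> \<bar>c\<bar>) \<and>
           (\<forall>A\<in>sets M. \<nu> A = (LINT x|M. indicator A x * g x))"
proof -
  \<comment> \<open>The positive measure to which the Radon--Nikodym theorem is applied.\<close>
  define N where "N A = ennreal (\<nu> A + c * measure M A)" for A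
  have nonneg: "0 \<le> \<nu> A + c * measure M A" and le: "\<nu> A + c * measure M A \<le> 2 * c * measure M A"
    if "A \<in> sets M" for A using bound[OF that] by auto
  have pos: "positive (sets M) N" 
    using bound[of "{}"] by (simp add: positive_def N_def)
  have "additive (sets M) N" unfolding additive_def
  proof (intro ballI impI)
    fix A B assume AB: "A \<in> sets M" "B \<in> sets M" "A \<inter> B = {}"
    show "N (A \<union> B) = N A + N B"
      using add[OF AB] nonneg[OF AB(1)] nonneg[OF AB(2)] AB
      by (simp add: N_def ennreal_plus[symmetric] finite_measure_Union algebra_simps del: ennreal_plus)
  qed
  then have ca: "countably_additive (sets M) N"
  proof (rule sets.empty_continuous_imp_countably_additive[OF pos])
    fix A :: "nat \<Rightarrow> 'a set" assume A: "range A \<subseteq> sets M" "decseq A" "(\<Inter>i. A i) = {}"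
    have "(\<lambda>i. measure M (A i)) \<longlonglongrightarrow> measure M (\<Inter>i. A i)"
      using A by (intro finite_Lim_measure_decseq) auto
    then have "(\<lambda>i. ennreal (2 * c * measure M (A i))) \<longlonglongrightarrow> ennreal (2 * c * 0)"
      using tendsto_ennrealI[OF tendsto_mult_left, of "\<lambda>i. measure M (A i)" 0] A by simp
    then have lim: "(\<lambda>i. ennreal (2 * c * measure M (A i))) \<longlonglongrightarrow> 0" by simp
    show "(\<lambda>i. N (A i)) \<longlonglongrightarrow> 0"
    proof (intro tendsto_sandwich[where f = "\<lambda>_. 0" and g = "\<lambda>i. N (A i)"])
      show "\<forall>\<^sub>F i in sequentially. N (A i) \<le> ennreal (2 * c * measure M (A i))"
        using A le unfolding N_def by (intro always_eventually allI ennreal_leI) auto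
    qed (use lim in auto)
  qed (simp add: N_def)
  define L where "L = measure_of (space M) (sets M) N"
  have sL: "sets L = sets M" and eL: "\<And>A. A \<in> sets M \<Longrightarrow> emeasure L A = N A"
    unfolding L_def using pos ca sets.sigma_algebra_axioms[of M]
    by (auto simp: emeasure_measure_of_sigma)
  have "absolutely_continuous M L"
    unfolding absolutely_continuous_def
  proof
    fix A assume A: "A \<in> null_sets M"
    then have "measure M A = 0" "A \<in> sets M" by (auto simp: measure_def)
    then show "A \<in> null_sets L" using bound[of A] by (auto simp: null_sets_def sL eL N_def)
  qed
  from Radon_Nikodym[OF this sL] obtain f where f: "f \<in> borel_measurable M" "density M f = L"
    by blast
  have N_eq: "N A = (\<integral>\<^sup>+x. f x * indicator A x \<partial>M)" if "A \<in> sets M" for A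
    using eL[OF that] f that by (simp add: emeasure_density[symmetric])
  have fin: "(\<integral>\<^sup>+x. f x \<partial>M) < \<infinity>"
  proof -
    have "(\<integral>\<^sup>+x. f x \<partial>M) = N (space M)"
      using N_eq[of "space M"] by (simp cong: nn_integral_cong)
    then show ?thesis by (simp add: N_def)
  qed
  define g where "g x = enn2real (f x) - c" for x
  have [measurable]: "f \<in> borel_measurable M" by fact
  have gm: "g \<in> borel_measurable M" unfolding g_def by measurable
  have ae: "AE x in M. f x = ennreal (enn2real (f x))"
  proof -
    have "AE x in M. f x \<noteq> \<infinity>" using fin by (intro nn_integral_PInf_AE) auto
    then show ?thesis by eventually_elim (simp add: less_top)
  qed
  have fi: "integrable M (\<lambda>x. enn2real (f x))"
  proof (rule integrableI_nonneg)
    have "(\<integral>\<^sup>+x. ennreal (enn2real (f x)) \<partial>M) = (\<integral>\<^sup>+x. f x \<partial>M)"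
      using ae by (intro nn_integral_cong_AE) auto
    then show "(\<integral>\<^sup>+x. ennreal (enn2real (f x)) \<partial>M) < \<infinity>" using fin by simp
  qed auto
  then have gi: "integrable M g" unfolding g_def by simp
  have \<nu>: "\<nu> A = (LINT x|M. indicator A x * g x)" if A: "A \<in> sets M" for A
  proof -
    have i1: "integrable M (\<lambda>x. indicator A x * enn2real (f x))"
      using integrable_mult_indicator[OF A fi] by simp
    have i2: "integrable M (\<lambda>x. indicator A x * c)"
      using integrable_mult_indicator[OF A, of "\<lambda>_. c"] by simp
    have "ennreal (LINT x|M. indicator A x * enn2real (f x)) = (\<integral>\<^sup>+x. ennreal (indicator A x * enn2real (f x)) \<partial>M)"
      using i1 by (intro nn_integral_eq_integral[symmetric]) auto
    also have "\<dots> = N A" unfolding N_eq[OF A]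
      by (rule nn_integral_cong_AE, use ae in eventually_elim) (auto simp: indicator_def)
    finally have "(LINT x|M. indicator A x * enn2real (f x)) = \<nu> A + c * measure M A"
      using nonneg[OF A] by (simp add: N_def ennreal_inj)
    then show ?thesis using A i1 i2 by (simp add: g_def right_diff_distrib)
  qed
  have bd: "AE x in M. g x \<in> {- c..c}"
  proof (rule averaging_theorem[OF gi closed_real_atLeastAtMost])
    fix A assume A: "A \<in> sets M" "measure M A > 0"
    have "(1 / measure M A) *\<^sub>R set_lebesgue_integral M A g = \<nu> A / measure M A"
      using \<nu>[OF A(1)] by (simp add: set_lebesgue_integral_def)
    then show "(1 / measure M A) *\<^sub>R set_lebesgue_integral M A g \<in> {- c..c}"
      using bound[OF A(1)] A(2) by (auto simp: field_simps abs_le_iff)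
  qed
  define g' where "g' x = max (- \<bar>c\<bar>) (min \<bar>c\<bar> (g x))" for x
  have "g' \<in> borel_measurable M" using gm unfolding g'_def by measurable
  moreover have "\<bar>g' x\<bar> \<le> \<bar>c\<bar>" for x by (auto simp: g'_def)
  moreover have "\<nu> A = (LINT x|M. indicator A x * g' x)" if A: "A \<in> sets M" for A
    unfolding \<nu>[OF A]
  proof (rule integral_cong_AE)
    show "AE x in M. indicator A x * g x = indicator A x * g' x"
      using bd by eventually_elim (auto simp: g'_def)
  qed (use A gm calculation(1) in measurable)
  ultimately show ?thesis by blast
qed

context compact_regular_probability
begin

text \<open>The dual of \<open>L\<^sup>1(M)\<close> is \<open>L\<^sup>\<infinity>(M)\<close>: the extension to \<open>L\<^sup>1(M)\<close>, evaluated at indicators, is a complex set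
function dominated by \<open>M\<close>, whose real and imaginary parts have densities. The
norm estimate for the density is what makes \<open>L\<^sup>1(K,M)\<close> norm closed in the dual later on. The factor
2 comes from estimating the real and imaginary parts separately, each by
testing against the function \<open>2 1\<^sub>A - 1\<close> for the set \<open>A\<close> on which that part is nonnegative.\<close>

lemma bounded_density:
  fixes \<phi> :: "'k functional"
  assumes \<phi>: "\<phi> \<in> dual_C"
    and bound: "\<And>f. cmod (blinfun_apply \<phi> f) \<le> c * (LINT x|M. cmod (apply_bcontfun f x))"
    and c: "0 \<le> c"
  shows "\<exists>h. integrable M h \<and> (\<forall>f. blinfun_apply \<phi> f = (LINT x|M. h x * apply_bcontfun f x)) \<and>
             (LINT x|M. cmod (h x)) \<le> 2 * norm \<phi>"
proof -
  obtain \<Phi> :: "('k \<Rightarrow> complex) \<Rightarrow> complex" where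
        Phi_add: "\<And>u v. integrable M u \<Longrightarrow> integrable M v \<Longrightarrow> \<Phi> (\<lambda>x. u x + v x) = \<Phi> u + \<Phi> v"
    and scale: "\<And>u a. integrable M u \<Longrightarrow> \<Phi> (\<lambda>x. a * u x) = a * \<Phi> u"
    and bnd: "\<And>u. integrable M u \<Longrightarrow> cmod (\<Phi> u) \<le> c * (LINT x|M. cmod (u x))"
    and Phi_ext: "\<And>f. \<Phi> (apply_bcontfun f) = blinfun_apply \<phi> f"
    using bounded_extension[OF \<phi> bound c] by blast
  have ind: "complex_integrable M (indicator A)" if "A \<in> sets M" for A
    using that by (intro integrable_const_bound[where B = 1]) (auto simp: indicator_def)
  have ind_norm: "(LINT x|M. cmod (indicator A x)) = measure M A" if "A \<in> sets M" for A
  proof -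
    have "cmod (indicator A x) = indicator A x" for x :: 'k by (auto simp: indicator_def)
    then show ?thesis using that by (simp add: space_eq)
  qed
  have ind_add: "\<Phi> (indicator (A \<union> B)) = \<Phi> (indicator A) + \<Phi> (indicator B)"
    if "A \<in> sets M" "B \<in> sets M" "A \<inter> B = {}" for A B
  proof -
    have "indicator (A \<union> B) = (\<lambda>x. indicator A x + indicator B x :: complex)"
      using that(3) by (auto simp: indicator_def fun_eq_iff)
    then show ?thesis using Phi_add[OF ind ind] that by simp
  qed
  have ind_bnd: "cmod (\<Phi> (indicator A)) \<le> c * measure M A" if "A \<in> sets M" for A
    using bnd[OF ind[OF that]] ind_norm[OF that] by simp
  have "\<exists>g :: 'k \<Rightarrow> real. g \<in> borel_measurable M \<and> (\<forall>x. \<bar>g x\<bar> \<le> \<bar>c\<bar>) \<and>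
           (\<forall>A\<in>sets M. Re (\<Phi> (indicator A)) = (LINT x|M. indicator A x * g x))"
    by (rule bounded_additive_density)
      (auto simp: ind_add intro: order_trans[OF abs_Re_le_cmod ind_bnd])
  then obtain g1 :: "'k \<Rightarrow> real" where g1 [measurable]: "g1 \<in> borel_measurable M" 
    and g1': "\<And>x. \<bar>g1 x\<bar> \<le> c"
      "\<And>A. A \<in> sets M \<Longrightarrow> Re (\<Phi> (indicator A)) = (LINT x|M. indicator A x * g1 x)"
    using c by auto
  have "\<exists>g :: 'k \<Rightarrow> real. g \<in> borel_measurable M \<and> (\<forall>x. \<bar>g x\<bar> \<le> \<bar>c\<bar>) \<and>
           (\<forall>A\<in>sets M. Im (\<Phi> (indicator A)) = (LINT x|M. indicator A x * g x))"
    by (rule bounded_additive_density)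
      (auto simp: ind_add intro: order_trans[OF abs_Im_le_cmod ind_bnd])
  then obtain g2 :: "'k \<Rightarrow> real" where g2 [measurable]: "g2 \<in> borel_measurable M" 
    and g2': "\<And>x. \<bar>g2 x\<bar> \<le> c"
      "\<And>A. A \<in> sets M \<Longrightarrow> Im (\<Phi> (indicator A)) = (LINT x|M. indicator A x * g2 x)"
    using c by auto
  define h where "h x = Complex (g1 x) (g2 x)" for x
  have h_eq: "h x = of_real (g1 x) + \<i> * of_real (g2 x)" for x
    by (simp add: h_def complex_eq_iff)
  have h_meas [measurable]: "h \<in> borel_measurable M" unfolding h_eq by measurable
  have h_bd: "cmod (h x) \<le> 2 * c" for x
    using cmod_le[of "h x"] g1'(1)[of x] g2'(1)[of x] by (simp add: h_def)
  have h_int: "integrable M h"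
    by (rule integrable_const_bound[where B = "2 * c"]) (auto simp: h_bd)
  have uh_int: "integrable M (\<lambda>x. u x * h x)" if "integrable M u" for u :: "'k \<Rightarrow> complex"
  proof (rule Bochner_Integration.integrable_bound)
    show "integrable M (\<lambda>x. cmod (u x) * (2 * c))" using that by simp
    show "AE x in M. cmod (u x * h x) \<le> norm (cmod (u x) * (2 * c))"
      using c by (auto simp: norm_mult intro!: mult_left_mono h_bd)
  qed (use that in measurable)
  have rep: "\<Phi> u = (LINT x|M. u x * h x)" if "integrable M u" for u
    using that
  proof (induction rule: integrable_induct)
    case (base A a)
    have i1: "integrable M (\<lambda>x. indicator A x * g1 x)" and i2: "integrable M (\<lambda>x. indicator A x * g2 x)"
      using base g1'(1) g2'(1) c
      by (auto intro!: integrable_const_bound[where B = c] simp: indicator_def)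
    have "(LINT x|M. indicator A x * h x) = 
       (LINT x|M. complex_of_real (indicator A x * g1 x) + \<i> * complex_of_real (indicator A x * g2 x))"
      by (intro Bochner_Integration.integral_cong) (auto simp: h_eq indicator_def)
    also have "\<dots> = (LINT x|M. complex_of_real (indicator A x * g1 x)) 
         + \<i> * (LINT x|M. complex_of_real (indicator A x * g2 x))"
      using i1 i2 by (subst Bochner_Integration.integral_add)
         (simp_all only: integrable_mult_right integrable_of_real integral_mult_right_zero)
    also have "\<dots> = of_real (LINT x|M. indicator A x * g1 x) + \<i> * of_real (LINT x|M. indicator A x * g2 x)"
      by (simp only: integral_complex_of_real)
    also have "\<dots> = \<Phi> (indicator A)" using g1'(2)[OF base(1)] g2'(2)[OF base(1)]
      by (simp add: complex_eq_iff)
    finally have *: "\<Phi> (indicator A) = (LINT x|M. indicator A x * h x)" ..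
    have "(\<lambda>x. indicator A x *\<^sub>R a) = (\<lambda>x. a * indicator A x)"
      by (auto simp: indicator_def)
    then have "\<Phi> (\<lambda>x. indicator A x *\<^sub>R a) = a * (LINT x|M. indicator A x * h x)"
      using scale[OF ind[OF base(1)], of a] * by simp
    also have "\<dots> = (LINT x|M. a * (indicator A x * h x))" by simp
    also have "\<dots> = (LINT x|M. (indicator A x *\<^sub>R a) * h x)"
      by (intro Bochner_Integration.integral_cong) (auto simp: indicator_def)
    finally show ?case .
  next
    case (add u v)
    then show ?case using assms by (simp add: Phi_add
       distrib_right uh_int)
  next
    case (lim u s)
    have "(\<lambda>i. LINT x|M. cmod (s i x - u x)) \<longlonglongrightarrow> (LINT x|M. 0)"
    proof (rule integral_dominated_convergence[where w = "\<lambda>x. 3 * cmod (u x)"])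
      show "AE x in M. (\<lambda>i. cmod (s i x - u x)) \<longlonglongrightarrow> 0"
      proof (rule AE_I2)
        fix x assume "x \<in> space M"
        from tendsto_norm[OF tendsto_diff[OF lim.hyps(2)[OF this] tendsto_const[of "u x"]]]
        show "(\<lambda>i. cmod (s i x - u x)) \<longlonglongrightarrow> 0" by simp
      qed
      show "AE x in M. norm (cmod (s i x - u x)) \<le> 3 * cmod (u x)" for i
        using lim.hyps(3) by (intro AE_I2) (smt (verit) norm_triangle_ineq4 real_norm_def norm_ge_zero)
    qed (use lim in auto)
    then have z: "(\<lambda>i. LINT x|M. cmod (s i x - u x)) \<longlonglongrightarrow> 0" by simp
    have sub: "\<Phi> (s i) - \<Phi> u = \<Phi> (\<lambda>x. s i x - u x)" for i
      using Phi_add[OF lim.hyps(1)[of i], of "\<lambda>x. - 1 * u x"] scale[of u "-1"] lim.hyps by simp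
    have "(\<lambda>i. \<Phi> (s i) - \<Phi> u) \<longlonglongrightarrow> 0"
    proof (rule Lim_null_comparison)
      show "\<forall>\<^sub>F i in sequentially. cmod (\<Phi> (s i) - \<Phi> u) \<le> c * (LINT x|M. cmod (s i x - u x))"
        unfolding sub using lim.hyps by (intro always_eventually allI bnd) auto
      show "(\<lambda>i. c * (LINT x|M. cmod (s i x - u x))) \<longlonglongrightarrow> 0"
        using tendsto_mult_left[OF z, of c] by simp
    qed
    then have 1: "(\<lambda>i. \<Phi> (s i)) \<longlonglongrightarrow> \<Phi> u" by (simp add: LIM_zero_iff)
    have "(\<lambda>i. (LINT x|M. s i x * h x)) \<longlonglongrightarrow> (LINT x|M. u x * h x)"
    proof (rule integral_dominated_convergence[where w = "\<lambda>x. 2 * cmod (u x) * (2 * c)"])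
      show "AE x in M. (\<lambda>i. s i x * h x) \<longlonglongrightarrow> u x * h x"
        by (intro AE_I2 tendsto_mult lim.hyps(2) tendsto_const)
      show "AE x in M. norm (s i x * h x) \<le> 2 * cmod (u x) * (2 * c)" for i
        unfolding norm_mult by (intro AE_I2 mult_mono lim.hyps(3) h_bd) auto
    qed (use lim in auto)
    then have "(\<lambda>i. \<Phi> (s i)) \<longlonglongrightarrow> (LINT x|M. u x * h x)" using lim.IH by simp
    with 1 show ?case using LIMSEQ_unique by blast
  qed
  \<comment> \<open>The bound by the norm of \<open>\<phi>\<close> holds for continuous functions of modulus at most one; the sign
    function is their limit in \<open>L\<^sup>1(M)\<close>, where \<open>\<Phi>\<close> is continuous.\<close>
  have sign_bound: "cmod (\<Phi> (\<lambda>x. 2 * indicator A x - 1)) \<le> norm \<phi>" if A: "A \<in> sets M" for A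
  proof (rule field_le_epsilon)
    fix e :: real assume e: "e > 0"
    \<comment> \<open>The summand 1 covers the case that \<open>c\<close> is 0.\<close>
    have "e / (2 * c + 1) > 0" using e c by simp
    then obtain f :: "'k \<Rightarrow>\<^sub>C complex" where f: "\<And>x. cmod (2 * apply_bcontfun f x - 1) \<le> 1"
       "(LINT x|M. cmod (indicator A x - apply_bcontfun f x)) < e / (2 * c + 1)"
      using indicator_approx[OF A] by blast
    let ?v = "2 *\<^sub>R f - const_bcontfun 1"
    have v: "apply_bcontfun ?v x = 2 * apply_bcontfun f x - 1" for x
      by (simp add: scaleR_bcontfun.rep_eq const_bcontfun.rep_eq scaleR_conv_of_real)
    let ?d = "\<lambda>x. 2 * (indicator A x - apply_bcontfun f x)"
    have d_int: "integrable M ?d" using ind[OF A] by simp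
    have "(\<lambda>x. 2 * indicator A x - 1) = (\<lambda>x. ?d x + apply_bcontfun ?v x)"
      by (rule ext) (simp only: v, simp add: algebra_simps)
    then have "\<Phi> (\<lambda>x. 2 * indicator A x - 1) = \<Phi> ?d + blinfun_apply \<phi> ?v"
      by (simp only: Phi_add[OF d_int integrable_apply_bcontfun] Phi_ext)
    moreover have "cmod (blinfun_apply \<phi> ?v) \<le> norm \<phi>"
    proof -
      have "norm ?v \<le> 1" by (rule norm_bound) (simp only: v f)
      then have "norm \<phi> * norm ?v \<le> norm \<phi> * 1" by (intro mult_left_mono) auto
      then show ?thesis using norm_blinfun[of \<phi> ?v] by simp
    qed
    moreover have "cmod (\<Phi> ?d) \<le> e"
    proof -
      have "cmod (\<Phi> ?d) \<le> c * (2 * (LINT x|M. cmod (indicator A x - apply_bcontfun f x)))"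
        using bnd[OF d_int] by (simp only: norm_mult norm_numeral integral_mult_right_zero)
      also have "\<dots> \<le> (2 * c + 1) * (LINT x|M. cmod (indicator A x - apply_bcontfun f x))"
        by (simp add: algebra_simps)
      also have "\<dots> \<le> (2 * c + 1) * (e / (2 * c + 1))"
        using f(2) c by (intro mult_left_mono) auto
      also have "\<dots> = e" using c by simp
      finally show ?thesis .
    qed
    ultimately show "cmod (\<Phi> (\<lambda>x. 2 * indicator A x - 1)) \<le> norm \<phi> + e"
      using norm_triangle_ineq[of "\<Phi> ?d" "blinfun_apply \<phi> ?v"] by simp
  qed
  have sgn_int: "integrable M (\<lambda>x. 2 * indicator A x - (1::complex))" if "A \<in> sets M" for A
    using ind[OF that] by simp
  have g_abs: "(LINT x|M. \<bar>g x\<bar>) \<le> norm \<phi>"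
    if g: "g = (\<lambda>x. Re (h x)) \<or> g = (\<lambda>x. Im (h x))" for g
  proof -
    have [measurable]: "g \<in> borel_measurable M" using g by auto
    let ?A = "{x \<in> space M. 0 \<le> g x}"
    let ?s = "\<lambda>x. 2 * indicator ?A x - 1"
    have A: "?A \<in> sets M" by measurable
    have sh: "integrable M (\<lambda>x. ?s x * h x)" by (rule uh_int[OF sgn_int[OF A]])
    have "(LINT x|M. \<bar>g x\<bar>) \<le> cmod (LINT x|M. ?s x * h x)"
    proof (cases "g = (\<lambda>x. Re (h x))")
      case True
      have "(LINT x|M. \<bar>g x\<bar>) = (LINT x|M. Re (?s x * h x))"
        by (intro Bochner_Integration.integral_cong) (auto simp: True indicator_def)
      also have "\<dots> = Re (LINT x|M. ?s x * h x)" by (rule integral_Re[OF sh])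
      finally show ?thesis by (simp add: complex_Re_le_cmod)
    next
      case False
      with g have g: "g = (\<lambda>x. Im (h x))" by blast
      have "(LINT x|M. \<bar>g x\<bar>) = (LINT x|M. Im (?s x * h x))"
        by (intro Bochner_Integration.integral_cong) (auto simp: g indicator_def)
      also have "\<dots> = Im (LINT x|M. ?s x * h x)" by (rule integral_Im[OF sh])
      finally show ?thesis using abs_Im_le_cmod[of "LINT x|M. ?s x * h x"] by linarith
    qed
    also have "\<dots> \<le> norm \<phi>" using sign_bound[OF A] rep[OF sgn_int[OF A]] by simp
    finally show ?thesis .
  qed
  have "(LINT x|M. cmod (h x)) \<le> (LINT x|M. \<bar>Re (h x)\<bar> + \<bar>Im (h x)\<bar>)"
    using h_int by (intro integral_mono cmod_le) auto
  also have "\<dots> = (LINT x|M. \<bar>Re (h x)\<bar>) + (LINT x|M. \<bar>Im (h x)\<bar>)"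
    using h_int by simp
  also have "\<dots> \<le> 2 * norm \<phi>" using g_abs[of "\<lambda>x. Re (h x)"] g_abs[of "\<lambda>x. Im (h x)"] by simp
  finally have "(LINT x|M. cmod (h x)) \<le> 2 * norm \<phi>" .
  moreover have "blinfun_apply \<phi> f = (LINT x|M. h x * apply_bcontfun f x)" for f
    using rep[of "apply_bcontfun f"] Phi_ext[of f] by (simp add: mult.commute)
  ultimately show ?thesis using h_int by blast
qed

text \<open>These are the measures \<open>h M\<close> with bounded density \<open>h\<close>. Stated as a bound on values, the condition is
preserved under weak* limits for fixed \<open>c\<close>.\<close>

definition bounded_density_functional :: "'k functional \<Rightarrow> bool" where
  "bounded_density_functional \<psi> \<longleftrightarrow> \<psi> \<in> dual_C \<and>
     (\<exists>c\<ge>0. \<forall>f. cmod (blinfun_apply \<psi> f) \<le> c * (LINT x|M. cmod (apply_bcontfun f x)))"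

lemma bounded_density_functional_diff:
  assumes "bounded_density_functional \<phi>" "bounded_density_functional \<psi>"
  shows "bounded_density_functional (\<phi> - \<psi>)"
proof -
  obtain c d where c: "c \<ge> 0" "\<And>f. cmod (blinfun_apply \<phi> f) \<le> c * (LINT x|M. cmod (apply_bcontfun f x))"
    and d: "d \<ge> 0" "\<And>f. cmod (blinfun_apply \<psi> f) \<le> d * (LINT x|M. cmod (apply_bcontfun f x))"
    using assms unfolding bounded_density_functional_def by blast
  have "cmod (blinfun_apply (\<phi> - \<psi>) f) \<le> (c + d) * (LINT x|M. cmod (apply_bcontfun f x))" for f
    using c(2)[of f] d(2)[of f] norm_triangle_ineq4[of "blinfun_apply \<phi> f" "blinfun_apply \<psi> f"]
    by (simp add: blinfun.diff_left distrib_right)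
  moreover have "\<phi> - \<psi> \<in> dual_C"
    using assms by (intro dual_C_diff) (auto simp: bounded_density_functional_def)
  ultimately show ?thesis unfolding bounded_density_functional_def
    using c(1) d(1) by (metis add_nonneg_nonneg)
qed

text \<open>Approximants at distance at most \<open>2\<^bsup>- n\<^esup>\<close> have norm summable consecutive differences. The densities of the differences are then summable in
\<open>L\<^sup>1(M)\<close> by the estimate in \<open>bounded_density\<close>, and their sum is a density of the limit.\<close>

lemma approx_imp_L1_space:
  assumes \<phi>: "\<phi> \<in> dual_C"
    and approx: "\<And>e. e > 0 \<Longrightarrow> \<exists>\<psi>. bounded_density_functional \<psi> \<and> norm (\<phi> - \<psi>) \<le> e"
  shows "\<phi> \<in> L1_space M"
proof -
  have "\<forall>n. \<exists>\<psi>. bounded_density_functional \<psi> \<and> norm (\<phi> - \<psi>) \<le> (1/2) ^ n"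
    by (intro allI approx) simp
  then obtain \<psi> where \<psi>: "\<And>n. bounded_density_functional (\<psi> n)" "\<And>n. norm (\<phi> - \<psi> n) \<le> (1/2) ^ n"
    by metis
  define d where "d n = \<psi> (Suc n) - \<psi> n" for n
  have d: "bounded_density_functional (d n)" for n
    by (simp add: d_def bounded_density_functional_diff \<psi>)
  have nd: "norm (d n) \<le> 2 * (1/2) ^ n" for n
  proof -
    have "norm (d n) = norm ((\<phi> - \<psi> n) - (\<phi> - \<psi> (Suc n)))" by (simp add: d_def)
    also have "\<dots> \<le> norm (\<phi> - \<psi> n) + norm (\<phi> - \<psi> (Suc n))" by (rule norm_triangle_ineq4)
    also have "\<dots> \<le> (1/2) ^ n + (1/2) ^ Suc n" by (intro add_mono \<psi>)
    also have "\<dots> \<le> 2 * (1/2) ^ n" by simp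
    finally show ?thesis .
  qed
  have dens: "\<exists>h. integrable M h \<and> (\<forall>f. blinfun_apply \<xi> f = (LINT x|M. h x * apply_bcontfun f x)) \<and>
             (LINT x|M. cmod (h x)) \<le> 2 * norm \<xi>" if "bounded_density_functional \<xi>" for \<xi>
    using that bounded_density unfolding bounded_density_functional_def by blast
  have "\<forall>n. \<exists>h. integrable M h \<and> (\<forall>f. blinfun_apply (d n) f = (LINT x|M. h x * apply_bcontfun f x)) \<and>
             (LINT x|M. cmod (h x)) \<le> 2 * norm (d n)"
    using dens d by blast
  then obtain h where h_int: "\<And>n. integrable M (h n)"
    and h_rep: "\<And>n f. blinfun_apply (d n) f = (LINT x|M. h n x * apply_bcontfun f x)"
    and h_norm: "\<And>n. (LINT x|M. cmod (h n x)) \<le> 2 * norm (d n)"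
    by metis
  have h_meas: "h n \<in> borel_measurable M" for n using h_int by auto
  obtain h0 where h0_int: "integrable M h0"
    and h0_rep: "\<And>f. blinfun_apply (\<psi> 0) f = (LINT x|M. h0 x * apply_bcontfun f x)"
    using dens[OF \<psi>(1)[of 0]] by blast
  have h_le: "(LINT x|M. cmod (h n x)) \<le> 4 * (1/2) ^ n" for n
    using h_norm[of n] nd[of n] by simp
  have sum_int: "summable (\<lambda>n. LINT x|M. cmod (h n x))"
    by (rule summable_comparison_test'[where g = "\<lambda>n. 4 * (1/2) ^ n" and N = 0])
      (use h_le in \<open>auto intro!: summable_mult summable_geometric\<close>)
  have ae: "AE x in M. summable (\<lambda>n. cmod (h n x))"
  proof -
    have "(\<integral>\<^sup>+x. (\<Sum>n. ennreal (cmod (h n x))) \<partial>M) = (\<Sum>n. \<integral>\<^sup>+x. ennreal (cmod (h n x)) \<partial>M)"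
      using h_meas by (intro nn_integral_suminf) measurable
    also have "\<dots> = (\<Sum>n. ennreal (LINT x|M. cmod (h n x)))"
      using h_int by (intro suminf_cong nn_integral_eq_integral) auto
    also have "\<dots> = ennreal (\<Sum>n. LINT x|M. cmod (h n x))"
      by (intro suminf_ennreal2 sum_int) simp
    finally have "(\<integral>\<^sup>+x. (\<Sum>n. ennreal (cmod (h n x))) \<partial>M) \<noteq> \<infinity>" by simp
    then have "AE x in M. (\<Sum>n. ennreal (cmod (h n x))) \<noteq> \<infinity>"
      using h_meas by (intro nn_integral_PInf_AE) measurable
    then show ?thesis by eventually_elim (auto intro: summable_suminf_not_top)
  qed
  define H where "H x = h0 x + (\<Sum>n. h n x)" for x
  have H_int: "integrable M H" unfolding H_def
    using h0_int integrable_suminf[OF h_int ae sum_int] by simp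
  have "blinfun_apply \<phi> f = (LINT x|M. H x * apply_bcontfun f x)" for f
  proof -
    have fi: "integrable M (\<lambda>x. h n x * apply_bcontfun f x)" for n
      by (rule integrable_mult_bcontfun[OF h_int])
    have fae: "AE x in M. summable (\<lambda>n. norm (h n x * apply_bcontfun f x))"
      using ae by eventually_elim (simp add: norm_mult summable_mult2)
    have fsum: "summable (\<lambda>n. LINT x|M. norm (h n x * apply_bcontfun f x))"
    proof (rule summable_comparison_test'[where N = 0])
      show "summable (\<lambda>n. (LINT x|M. cmod (h n x)) * norm f)" by (intro summable_mult2 sum_int)
      fix n
      have "(LINT x|M. norm (h n x * apply_bcontfun f x)) \<le> (LINT x|M. cmod (h n x) * norm f)"
        using h_int integrable_norm[OF fi] by (intro integral_mono) (auto simp: norm_mult intro!: mult_left_mono norm_bounded)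
      then show "norm (LINT x|M. norm (h n x * apply_bcontfun f x)) \<le> (LINT x|M. cmod (h n x)) * norm f"
        by simp
    qed
    have "(\<lambda>n. blinfun_apply (d n) f) sums (LINT x|M. (\<Sum>n. h n x * apply_bcontfun f x))"
      unfolding h_rep by (rule sums_integral[OF fi fae fsum])
    also have "(LINT x|M. (\<Sum>n. h n x * apply_bcontfun f x)) = (LINT x|M. (\<Sum>n. h n x) * apply_bcontfun f x)"
    proof (rule integral_cong_AE)
      show "AE x in M. (\<Sum>n. h n x * apply_bcontfun f x) = (\<Sum>n. h n x) * apply_bcontfun f x"
        using ae by eventually_elim (simp add: suminf_mult2 summable_norm_cancel)
    qed (use h_meas in measurable)
    finally have 1: "(\<lambda>n. blinfun_apply (d n) f) sums (LINT x|M. (\<Sum>n. h n x) * apply_bcontfun f x)" .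
    have "(\<lambda>n. \<psi> n) \<longlonglongrightarrow> \<phi>"
    proof -
      have "(\<lambda>n. \<phi> - \<psi> n) \<longlonglongrightarrow> 0"
        by (rule Lim_null_comparison[OF always_eventually[OF allI[OF \<psi>(2)]]])
          (auto intro: LIMSEQ_power_zero)
      from tendsto_diff[OF tendsto_const[of \<phi>] this] show ?thesis by simp
    qed
    then have "(\<lambda>n. blinfun_apply (\<psi> n) f) \<longlonglongrightarrow> blinfun_apply \<phi> f"
      by (intro blinfun.tendsto tendsto_const)
    then have "(\<lambda>n. blinfun_apply (d n) f) sums (blinfun_apply \<phi> f - blinfun_apply (\<psi> 0) f)"
      using telescope_sums[of "\<lambda>n. blinfun_apply (\<psi> n) f"] by (simp add: d_def blinfun.diff_left)
    with 1 have "blinfun_apply \<phi> f = blinfun_apply (\<psi> 0) f + (LINT x|M. (\<Sum>n. h n x) * apply_bcontfun f x)"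
      using sums_unique2 by fastforce
    also have "\<dots> = (LINT x|M. h0 x * apply_bcontfun f x + (\<Sum>n. h n x) * apply_bcontfun f x)"
      unfolding h0_rep
      by (intro Bochner_Integration.integral_add[symmetric] integrable_mult_bcontfun h0_int
          integrable_suminf[OF h_int ae sum_int])
    finally show ?thesis by (simp add: H_def distrib_right)
  qed
  with H_int \<phi> show ?thesis unfolding L1_space_def by blast
qed

text \<open>The approximants are obtained by cutting off the density where its modulus exceeds \<open>n\<close>.\<close>

lemma L1_space_imp_approx:
  assumes \<phi>: "\<phi> \<in> L1_space M" and e: "e > 0"
  shows "\<exists>\<psi>. bounded_density_functional \<psi> \<and> norm (\<phi> - \<psi>) \<le> e"
proof -
  obtain h where h: "integrable M h" and rep: "\<And>f. blinfun_apply \<phi> f = (LINT x|M. h x * apply_bcontfun f x)"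
    using \<phi> unfolding L1_space_def by blast
  have hm [measurable]: "h \<in> borel_measurable M" using h by auto
  define t where "t n x = (if cmod (h x) \<le> real n then h x else 0)" for n x
  have tm [measurable]: "t n \<in> borel_measurable M" for n unfolding t_def by measurable
  have ti: "integrable M (t n)" for n
    by (rule Bochner_Integration.integrable_bound[OF h tm]) (auto simp: t_def)
  have "(\<lambda>n. LINT x|M. cmod (h x - t n x)) \<longlonglongrightarrow> (LINT x|M. 0)"
  proof (rule integral_dominated_convergence[where w = "\<lambda>x. cmod (h x)"])
    show "AE x in M. (\<lambda>n. cmod (h x - t n x)) \<longlonglongrightarrow> 0"
    proof (rule AE_I2)
      fix x
      obtain N where "cmod (h x) \<le> real N" using real_arch_simple by blast
      then have "\<forall>\<^sub>F n in sequentially. cmod (h x - t n x) = 0"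
        unfolding eventually_sequentially t_def by (intro exI[of _ N]) auto
      then show "(\<lambda>n. cmod (h x - t n x)) \<longlonglongrightarrow> 0" by (rule tendsto_eventually)
    qed
  qed (use h in \<open>auto simp: t_def\<close>)
  then have "\<forall>\<^sub>F n in sequentially. (LINT x|M. cmod (h x - t n x)) < e"
    by (rule order_tendstoD) (use e in auto)
  then obtain n where n: "(LINT x|M. cmod (h x - t n x)) < e"
    by (auto simp: eventually_sequentially)
  define \<psi> :: "'k functional" where "\<psi> = Blinfun (\<lambda>f. LINT x|M. t n x * apply_bcontfun f x)"
  have tb: "cmod (LINT x|M. t n x * apply_bcontfun f x) \<le> real n * (LINT x|M. cmod (apply_bcontfun f x))" for f
  proof -
    have "cmod (LINT x|M. t n x * apply_bcontfun f x) \<le> (LINT x|M. cmod (t n x * apply_bcontfun f x))"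
      by (rule integral_norm_bound)
    also have "\<dots> \<le> (LINT x|M. real n * cmod (apply_bcontfun f x))"
      using integrable_norm[OF integrable_mult_bcontfun[OF ti, of n f]]
      by (intro integral_mono) (auto simp: norm_mult t_def intro!: mult_right_mono)
    finally show ?thesis by simp
  qed
  have "bounded_linear (\<lambda>f. LINT x|M. t n x * apply_bcontfun f x)"
  proof (rule bounded_linear_intro[where K = "LINT x|M. cmod (t n x)"])
    show "(LINT x|M. t n x * apply_bcontfun (f + g) x) =
        (LINT x|M. t n x * apply_bcontfun f x) + (LINT x|M. t n x * apply_bcontfun g x)" for f g
      by (simp add: distrib_left integrable_mult_bcontfun[OF ti])
    show "(LINT x|M. t n x * apply_bcontfun (r *\<^sub>R f) x) = r *\<^sub>R (LINT x|M. t n x * apply_bcontfun f x)" for r f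
      by (simp add: scaleR_bcontfun.rep_eq)
    show "cmod (LINT x|M. t n x * apply_bcontfun f x) \<le> norm f * (LINT x|M. cmod (t n x))" for f
    proof -
      have "cmod (LINT x|M. t n x * apply_bcontfun f x) \<le> (LINT x|M. cmod (t n x * apply_bcontfun f x))"
        by (rule integral_norm_bound)
      also have "\<dots> \<le> (LINT x|M. norm f * cmod (t n x))"
        using integrable_norm[OF integrable_mult_bcontfun[OF ti, of n f]] ti
        by (intro integral_mono) (auto simp: norm_mult mult.commute intro!: mult_right_mono norm_bounded)
      finally show ?thesis by simp
    qed
  qed
  then have \<psi>: "blinfun_apply \<psi> f = (LINT x|M. t n x * apply_bcontfun f x)" for f
    by (simp add: \<psi>_def bounded_linear_Blinfun_apply)
  have "\<psi> \<in> dual_C" by (auto simp: dual_C_def \<psi> mult.left_commute)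
  then have "bounded_density_functional \<psi>"
    unfolding bounded_density_functional_def \<psi> using tb by (intro conjI exI[of _ "real n"]) auto
  moreover have "norm (\<phi> - \<psi>) \<le> e"
  proof (rule norm_blinfun_bound)
    fix f
    have hi: "integrable M (\<lambda>x. (h x - t n x) * apply_bcontfun f x)"
      using h ti by (intro integrable_mult_bcontfun) auto
    have "cmod (blinfun_apply (\<phi> - \<psi>) f) = cmod (LINT x|M. (h x - t n x) * apply_bcontfun f x)"
      by (simp add: blinfun.diff_left rep \<psi> left_diff_distrib integrable_mult_bcontfun h ti)
    also have "\<dots> \<le> (LINT x|M. cmod ((h x - t n x) * apply_bcontfun f x))"
      by (rule integral_norm_bound)
    also have "\<dots> \<le> (LINT x|M. cmod (h x - t n x) * norm f)"
      using integrable_norm[OF hi] h ti by (intro integral_mono) (auto simp: norm_mult intro!: mult_left_mono norm_bounded)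
    also have "\<dots> \<le> e * norm f" using n by (simp add: mult_right_mono)
    finally show "cmod (blinfun_apply (\<phi> - \<psi>) f) \<le> e * norm f" .
  qed (use e in simp)
  ultimately show ?thesis by blast
qed

end

section \<open>The weak* topology and spaces of self-maps\<close>

abbreviation weak_star :: "('a::real_normed_vector \<Rightarrow>\<^sub>L complex) set \<Rightarrow> ('a \<Rightarrow>\<^sub>L complex) topology" where
  "weak_star X \<equiv> weak_topology X UNIV blinfun_apply"

lemma topspace_weak_topology [simp]: "topspace (weak_topology X Y b) = X"
  by (auto simp: weak_topology_def topology_generated_by_topspace)

lemma topspace_self_map_topology [simp]: "topspace (self_map_topology X Y b) = (X \<rightarrow>\<^sub>E X)"
  by (simp add: self_map_topology_def)

lemma continuous_map_weak_star_eval: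
  "continuous_map (weak_star X) euclidean (\<lambda>\<phi>. blinfun_apply \<phi> f)"
  unfolding continuous_map_def
proof (intro conjI allI impI)
  fix U :: "complex set" assume "openin euclidean U"
  then have U: "open U" by simp
  show "openin (weak_star X) {\<phi> \<in> topspace (weak_star X). blinfun_apply \<phi> f \<in> U}"
  proof (subst openin_subopen, intro ballI)
    fix \<phi> assume \<phi>: "\<phi> \<in> {\<phi> \<in> topspace (weak_star X). blinfun_apply \<phi> f \<in> U}"
    then obtain e where e: "e > 0" "ball (blinfun_apply \<phi> f) e \<subseteq> U"
      using U open_contains_ball[of U] by fastforce
    let ?B = "{\<psi> \<in> X. cmod (blinfun_apply (\<psi> - \<phi>) f) < e}"
    have "openin (weak_star X) ?B"
      unfolding weak_topology_def using \<phi> e(1) by (intro topology_generated_by_Basis) auto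
    moreover have "?B \<subseteq> {\<phi> \<in> topspace (weak_star X). blinfun_apply \<phi> f \<in> U}"
      using e(2) by (auto simp: blinfun.diff_left dist_norm norm_minus_commute subset_eq)
    moreover have "\<phi> \<in> ?B" using \<phi> e(1) by simp
    ultimately show "\<exists>T. openin (weak_star X) T \<and> \<phi> \<in> T \<and>
        T \<subseteq> {\<phi> \<in> topspace (weak_star X). blinfun_apply \<phi> f \<in> U}" by blast
  qed
qed simp

text \<open>This is the description of the weak* topology as the initial topology of the evaluations. It makes
the topologies on \<open>X\<close> and on a larger space comparable without any reference to neighbourhoods.\<close>

lemma continuous_map_weak_star_iff:
  "continuous_map T (weak_star X) g \<longleftrightarrow>
     g \<in> topspace T \<rightarrow> X \<and> (\<forall>f. continuous_map T euclidean (\<lambda>t. blinfun_apply (g t) f))"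
  (is "?L \<longleftrightarrow> ?R")
proof
  assume ?L
  then show ?R
    using continuous_map_compose[OF \<open>?L\<close> continuous_map_weak_star_eval] continuous_map_funspace[OF \<open>?L\<close>]
    by (auto simp: o_def)
next
  assume R: ?R
  show ?L unfolding weak_topology_def
  proof (rule continuous_on_generated_topo)
    fix U assume "U \<in> insert X {{x \<in> X. cmod (blinfun_apply (x - x0) y) < e} |x0 y e. x0 \<in> X \<and> y \<in> UNIV \<and> 0 < e}"
    then consider "U = X" | x0 y e where "U = {x \<in> X. cmod (blinfun_apply (x - x0) y) < e}" by blast
    then show "openin T (g -` U \<inter> topspace T)"
    proof cases
      case 1
      with R have "g -` U \<inter> topspace T = topspace T" by auto
      then show ?thesis by simp
    next
      case 2
      have "g -` U \<inter> topspace T = {t \<in> topspace T. blinfun_apply (g t) y \<in> ball (blinfun_apply x0 y) e}"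
        using R by (auto simp: 2 blinfun.diff_left dist_norm norm_minus_commute)
      also have "openin T \<dots>"
        using R by (intro openin_continuous_map_preimage[of T euclidean]) auto
      finally show ?thesis .
    qed
  qed (use R in auto)
qed

lemma Hausdorff_space_weak_star: "Hausdorff_space (weak_star X)"
proof (rule Hausdorff_space_injective_preimage)
  show "Hausdorff_space (product_topology (\<lambda>_. euclidean :: complex topology) UNIV)"
    by (simp add: Hausdorff_space_product_topology)
  show "continuous_map (weak_star X) (product_topology (\<lambda>_. euclidean) UNIV) blinfun_apply"
    by (simp add: continuous_map_componentwise_UNIV continuous_map_weak_star_eval)
  show "inj_on blinfun_apply (topspace (weak_star X))"
    by (simp add: inj_on_def blinfun_apply_inject)
qed

lemma Hausdorff_space_self_maps: "Hausdorff_space (self_map_topology X UNIV blinfun_apply)"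
  unfolding self_map_topology_def by (simp add: Hausdorff_space_product_topology Hausdorff_space_weak_star)

lemma continuous_map_self_maps_iff:
  "continuous_map T (self_map_topology X UNIV blinfun_apply) G \<longleftrightarrow>
     G \<in> topspace T \<rightarrow> (X \<rightarrow>\<^sub>E X) \<and>
     (\<forall>\<phi>\<in>X. \<forall>f. continuous_map T euclidean (\<lambda>t. blinfun_apply (G t \<phi>) f))"
  unfolding self_map_topology_def continuous_map_componentwise continuous_map_weak_star_iff
  by (auto simp: PiE_def Pi_iff)

lemma continuous_map_self_maps_eval:
  assumes "\<phi> \<in> X"
  shows "continuous_map (self_map_topology X UNIV blinfun_apply) (weak_star X) (\<lambda>R. R \<phi>)"
  unfolding self_map_topology_def using assms by (rule continuous_map_product_projection)

lemma continuous_map_self_maps_eval_apply: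
  assumes "\<phi> \<in> X"
  shows "continuous_map (self_map_topology X UNIV blinfun_apply) euclidean (\<lambda>R. blinfun_apply (R \<phi>) f)"
  using continuous_map_compose[OF continuous_map_self_maps_eval[OF assms] continuous_map_weak_star_eval]
  by (simp add: o_def)

text \<open>The Banach--Alaoglu theorem: the functions on \<open>C(K)\<close> with values in discs of radius \<open>r \<parallel>f\<parallel>\<close> form a
compact product, in which the complex-linear ones are a closed set.\<close>

lemma compactin_dual_ball:
  "compactin (weak_star (dual_C :: 'k::topological_space functional set)) {\<psi> \<in> dual_C. norm \<psi> \<le> r}"
proof (cases "0 \<le> r")
  case r: True
  let ?P = "product_topology (\<lambda>_ :: 'k \<Rightarrow>\<^sub>C complex. euclidean :: complex topology) UNIV"
  define B where "B = (\<Pi>\<^sub>E f\<in>(UNIV :: ('k \<Rightarrow>\<^sub>C complex) set). cball (0::complex) (r * norm f))"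
  define Z where "Z = B \<inter> {u. (\<forall>f g. u (f + g) = u f + u g) \<and>
     (\<forall>c f. u (c *\<^sub>R f) = c *\<^sub>R u f) \<and>
     (\<forall>c f g. (\<forall>x. apply_bcontfun g x = c * apply_bcontfun f x) \<longrightarrow> u g = c * u f)}"
  have "compactin ?P B" unfolding B_def by (simp add: compactin_PiE)
  moreover have "closedin ?P {u. (\<forall>f g. u (f + g) = u f + u g) \<and>
     (\<forall>c f. u (c *\<^sub>R f) = c *\<^sub>R u f) \<and>
     (\<forall>c f g. (\<forall>x. apply_bcontfun g x = c * apply_bcontfun f x) \<longrightarrow> u g = c * u f)}"
    unfolding euclidean_product_topology closed_closedin[symmetric]
    by (intro closed_Collect_conj closed_Collect_all closed_Collect_imp open_Collect_const closed_Collect_eq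
        continuous_intros continuous_on_product_coordinates)
  ultimately have Z: "compactin ?P Z" unfolding Z_def
    by (rule compact_Int_closedin)
  have bl: "bounded_linear u" if "u \<in> Z" for u
    by (rule bounded_linear_intro[where K = r]) (use that in \<open>auto simp: Z_def B_def mult.commute\<close>)
  have ap: "blinfun_apply (Blinfun u) = u" if "u \<in> Z" for u
    using bl[OF that] by (rule bounded_linear_Blinfun_apply)
  have "continuous_map (subtopology ?P Z) (weak_star dual_C) Blinfun"
    unfolding continuous_map_weak_star_iff
  proof (intro conjI allI)
    show "Blinfun \<in> topspace (subtopology ?P Z) \<rightarrow> dual_C"
      by (auto simp: ap dual_C_def) (auto simp: Z_def)
    fix f
    have "continuous_map (subtopology ?P Z) euclidean (\<lambda>u. u f)"
      by (intro continuous_map_from_subtopology continuous_map_product_projection) simp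
    then show "continuous_map (subtopology ?P Z) euclidean (\<lambda>u. blinfun_apply (Blinfun u) f)"
      by (rule continuous_map_eq) (simp add: ap)
  qed
  moreover have "compactin (subtopology ?P Z) Z" using Z by (simp add: compactin_subtopology)
  ultimately have "compactin (weak_star dual_C) (Blinfun ` Z)" by (metis image_compactin)
  also have "Blinfun ` Z = {\<psi> \<in> dual_C. norm \<psi> \<le> r}"
  proof (intro equalityI subsetI)
    fix \<psi> assume "\<psi> \<in> Blinfun ` Z"
    then obtain u where u: "u \<in> Z" "\<psi> = Blinfun u" by blast
    have "norm \<psi> \<le> r"
      by (rule norm_blinfun_bound[OF r]) (use u in \<open>auto simp: ap Z_def B_def\<close>)
    then show "\<psi> \<in> {\<psi> \<in> dual_C. norm \<psi> \<le> r}"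
      using u by (auto simp: ap dual_C_def) (auto simp: Z_def)
  next
    fix \<psi> :: "'k functional" assume \<psi>: "\<psi> \<in> {\<psi> \<in> dual_C. norm \<psi> \<le> r}"
    have "norm (blinfun_apply \<psi> f) \<le> r * norm f" for f
      using \<psi> norm_blinfun[of \<psi> f] by (smt (verit) mem_Collect_eq mult_right_mono norm_ge_zero)
    then have "blinfun_apply \<psi> \<in> Z"
      using \<psi> by (auto simp: Z_def B_def blinfun.add_right blinfun.scaleR_right dual_C_def)
    then show "\<psi> \<in> Blinfun ` Z" by (metis blinfun_apply_inverse image_eqI)
  qed
  finally show ?thesis .
next
  case False
  then have "{\<psi> \<in> dual_C. norm \<psi> \<le> r} = ({} :: 'k functional set)"
    by auto (meson norm_ge_zero order_trans)
  then show ?thesis by (simp only: compactin_empty)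
qed

section \<open>Closures of operator semigroups\<close>

abbreviation closure_on where "closure_on \<S> X \<equiv> operator_closure \<S> X UNIV blinfun_apply"

lemma operator_closure_subset: "operator_closure \<S> X Y b \<subseteq> X \<rightarrow>\<^sub>E X"
  unfolding operator_closure_def using closure_of_subset_topspace by fastforce

lemma topspace_operator_topology [simp]:
  "topspace (operator_topology X (closure_on \<S> X)) = closure_on \<S> X"
  unfolding operator_topology_def using operator_closure_subset[of \<S> X UNIV blinfun_apply] by auto

lemma restrict_in_operator_closure:
  assumes "U \<in> \<S>" "\<And>V. V \<in> \<S> \<Longrightarrow> V \<in> X \<rightarrow> X"
  shows "restrict U X \<in> closure_on \<S> X"
proof -
  have "(\<lambda>R. restrict R X) ` \<S> \<subseteq> topspace (self_map_topology X UNIV blinfun_apply)"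
    using assms(2)[THEN funcset_mem] by auto
  from closure_of_subset[OF this] show ?thesis using assms(1) unfolding operator_closure_def by blast
qed

text \<open>The estimates for elements of the closure rest on this principle: a closed
condition that holds for the generators holds on their closure.\<close>

lemma operator_closure_closed_condition:
  assumes R: "R \<in> closure_on \<S> X"
    and F: "continuous_map (self_map_topology X UNIV blinfun_apply) T F" and Z: "closedin T Z"
    and U: "\<And>U. U \<in> \<S> \<Longrightarrow> F (restrict U X) \<in> Z"
  shows "F R \<in> Z"
proof -
  let ?A = "(\<lambda>R. restrict R X) ` \<S>"
  have "F R \<in> T closure_of (F ` ?A)"
    using continuous_map_image_closure_subset[OF F, of ?A] R unfolding operator_closure_def by blast
  also have "\<dots> \<subseteq> Z" by (rule closure_of_minimal[OF _ Z]) (use U in auto)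
  finally show ?thesis .
qed

text \<open>Operators of this form are weak* continuous, also as maps of an invariant subspace.\<close>

definition has_preadjoint :: "('a::real_normed_vector \<Rightarrow>\<^sub>L complex \<Rightarrow> 'a \<Rightarrow>\<^sub>L complex) \<Rightarrow> bool" where
  "has_preadjoint U \<longleftrightarrow> (\<exists>V. \<forall>\<phi> f. blinfun_apply (U \<phi>) f = blinfun_apply \<phi> (V f))"

text \<open>Multiplication \<open>R \<circ> Q\<close> is continuous in \<open>R\<close> for every \<open>Q\<close>, but continuous in \<open>Q\<close> only when \<open>R\<close> is weak*
continuous, as the generators are. Hence products stay in the closure when \<open>R\<close> is
a generator, by closedness in \<open>Q\<close>, and then for all \<open>R\<close>, by closedness in \<open>R\<close>.\<close>

lemma right_topological_semigroup_operator_closure: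
  fixes \<S> :: "('k::topological_space functional \<Rightarrow> 'k functional) set"
  assumes inv: "\<And>U. U \<in> \<S> \<Longrightarrow> U \<in> X \<rightarrow> X"
    and pre: "\<And>U. U \<in> \<S> \<Longrightarrow> has_preadjoint U"
    and comp: "\<And>U V. U \<in> \<S> \<Longrightarrow> V \<in> \<S> \<Longrightarrow> U \<circ> V \<in> \<S>"
  shows "right_topological_semigroup (operator_topology X (closure_on \<S> X)) (compose X)"
proof -
  let ?T = "self_map_topology X UNIV (blinfun_apply :: 'k functional \<Rightarrow> _)"
  let ?A = "(\<lambda>R. restrict R X) ` \<S>"
  let ?C = "closure_on \<S> X"
  have C: "?C = ?T closure_of ?A" by (simp add: operator_closure_def)
  have CX: "R \<in> X \<rightarrow>\<^sub>E X" if "R \<in> ?C" for R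
    using that operator_closure_subset by blast
  have left: "continuous_map ?T ?T (\<lambda>R. compose X R Q)" if Q: "Q \<in> X \<rightarrow>\<^sub>E X" for Q
    unfolding continuous_map_self_maps_iff
  proof (intro conjI ballI allI)
    show "(\<lambda>R. compose X R Q) \<in> topspace ?T \<rightarrow> X \<rightarrow>\<^sub>E X"
      using Q by (auto simp: compose_def PiE_def Pi_iff)
    fix \<phi> f assume "\<phi> \<in> X"
    then show "continuous_map ?T euclidean (\<lambda>R. blinfun_apply (compose X R Q \<phi>) f)"
      using Q by (auto simp: compose_def intro!: continuous_map_self_maps_eval_apply)
  qed
  have right: "continuous_map ?T ?T (\<lambda>Q. compose X (restrict U X) Q)" if U: "U \<in> \<S>" for U
  proof -
    obtain V where V: "\<And>\<phi> f. blinfun_apply (U \<phi>) f = blinfun_apply \<phi> (V f)"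
      using pre[OF U] unfolding has_preadjoint_def by blast
    show ?thesis unfolding continuous_map_self_maps_iff
    proof (intro conjI ballI allI)
      show "(\<lambda>Q. compose X (restrict U X) Q) \<in> topspace ?T \<rightarrow> X \<rightarrow>\<^sub>E X"
        using inv[OF U] by (auto simp: compose_def PiE_def Pi_iff)
      fix \<phi> f assume \<phi>: "\<phi> \<in> X"
      have "continuous_map ?T euclidean (\<lambda>Q. blinfun_apply (Q \<phi>) (V f))"
        by (rule continuous_map_self_maps_eval_apply[OF \<phi>])
      then show "continuous_map ?T euclidean (\<lambda>Q. blinfun_apply (compose X (restrict U X) Q \<phi>) f)"
        by (rule continuous_map_eq) (use \<phi> in \<open>auto simp: compose_def V PiE_def Pi_iff\<close>)
    qed
  qed
  have closed_C: "closedin ?T ?C" by (simp add: C)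
  have 1: "compose X (restrict U X) Q \<in> ?C" if U: "U \<in> \<S>" and Q: "Q \<in> ?C" for U Q
  proof (rule operator_closure_closed_condition[OF Q right[OF U] closed_C])
    fix V assume V: "V \<in> \<S>"
    have "compose X (restrict U X) (restrict V X) = restrict (U \<circ> V) X"
      using inv[OF V] by (auto simp: compose_def fun_eq_iff Pi_iff)
    then show "compose X (restrict U X) (restrict V X) \<in> ?C"
      using restrict_in_operator_closure[OF comp[OF U V] inv] by simp
  qed
  have 2: "compose X R Q \<in> ?C" if R: "R \<in> ?C" and Q: "Q \<in> ?C" for R Q
    by (rule operator_closure_closed_condition[OF R left[OF CX[OF Q]] closed_C 1[OF _ Q]])
  have 3: "compose X (compose X R Q) P = compose X R (compose X Q P)" if "P \<in> ?C" for R Q P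
    using CX[OF that] by (auto simp: compose_def fun_eq_iff PiE_def Pi_iff)
  have 4: "continuous_map (operator_topology X ?C) (operator_topology X ?C) (\<lambda>R. compose X R Q)"
    if Q: "Q \<in> ?C" for Q
    unfolding operator_topology_def
    using left[OF CX[OF Q]] 2 Q
    by (auto simp: continuous_map_in_subtopology intro: continuous_map_from_subtopology)
  show ?thesis unfolding right_topological_semigroup_def topspace_operator_topology
    by (intro conjI ballI 2 3 4)
qed

text \<open>The contractions form a product of weak* compact balls.\<close>

lemma compactin_operator_closure:
  fixes \<S> :: "('k::topological_space functional \<Rightarrow> 'k functional) set"
  assumes inv: "\<And>U. U \<in> \<S> \<Longrightarrow> U \<in> dual_C \<rightarrow> dual_C"
    and contr: "\<And>U \<phi>. U \<in> \<S> \<Longrightarrow> norm (U \<phi>) \<le> norm \<phi>"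
  shows "compactin (self_map_topology dual_C UNIV blinfun_apply) (closure_on \<S> dual_C)"
proof -
  let ?T = "self_map_topology dual_C UNIV (blinfun_apply :: 'k functional \<Rightarrow> _)"
  let ?P = "\<Pi>\<^sub>E \<phi>\<in>dual_C. {\<psi> :: 'k functional. \<psi> \<in> dual_C \<and> norm \<psi> \<le> norm \<phi>}"
  have P: "compactin ?T ?P"
    unfolding self_map_topology_def compactin_PiE using compactin_dual_ball by blast
  then have "closedin ?T ?P" by (rule compactin_imp_closedin[OF Hausdorff_space_self_maps])
  then have "closure_on \<S> dual_C \<subseteq> ?P"
    unfolding operator_closure_def by (rule closure_of_minimal[rotated]) (use inv[THEN funcset_mem] contr in auto)
  then show ?thesis
    by (rule closed_compactin[OF P]) (simp add: operator_closure_def)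
qed

text \<open>The decisive point is surjectivity, where compactness of the closure on \<^const>\<open>dual_C\<close> replaces the
choice of a convergent subnet: its image is closed in the self-maps of \<open>X\<close> and contains the
restricted generators.\<close>

lemma rts_epimorphism_restrict:
  fixes \<S> :: "('k::topological_space functional \<Rightarrow> 'k functional) set"
  assumes inv: "\<And>U. U \<in> \<S> \<Longrightarrow> U \<in> dual_C \<rightarrow> dual_C"
    and contr: "\<And>U \<phi>. U \<in> \<S> \<Longrightarrow> norm (U \<phi>) \<le> norm \<phi>"
    and pre: "\<And>U. U \<in> \<S> \<Longrightarrow> has_preadjoint U"
    and comp: "\<And>U V. U \<in> \<S> \<Longrightarrow> V \<in> \<S> \<Longrightarrow> U \<circ> V \<in> \<S>"
    and X: "X \<subseteq> dual_C"
    and X_inv: "\<And>R. R \<in> closure_on \<S> dual_C \<Longrightarrow> R \<in> X \<rightarrow> X"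
  shows "rts_epimorphism
           (operator_topology dual_C (closure_on \<S> dual_C)) (compose dual_C)
           (operator_topology X (closure_on \<S> X)) (compose X) (\<lambda>R. restrict R X)"
proof -
  let ?D = "dual_C :: 'k functional set"
  let ?TD = "self_map_topology ?D UNIV (blinfun_apply :: 'k functional \<Rightarrow> _)"
  let ?TX = "self_map_topology X UNIV (blinfun_apply :: 'k functional \<Rightarrow> _)"
  let ?K = "closure_on \<S> ?D"
  let ?\<rho> = "\<lambda>R. restrict R X"
  have K: "R \<in> ?D \<rightarrow>\<^sub>E ?D" if "R \<in> ?K" for R
    using that operator_closure_subset by blast
  have inv_X: "U \<in> X \<rightarrow> X" if "U \<in> \<S>" for U
    using X_inv[OF restrict_in_operator_closure[OF that inv]] X by (auto simp: Pi_iff subset_eq)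
  have cont: "continuous_map (subtopology ?TD ?K) ?TX ?\<rho>"
    unfolding continuous_map_self_maps_iff
  proof (intro conjI ballI allI)
    show "?\<rho> \<in> topspace (subtopology ?TD ?K) \<rightarrow> X \<rightarrow>\<^sub>E X" using X_inv by auto
    fix \<phi> f assume "\<phi> \<in> X"
    then show "continuous_map (subtopology ?TD ?K) euclidean (\<lambda>R. blinfun_apply (restrict R X \<phi>) f)"
      using X by (auto intro!: continuous_map_from_subtopology continuous_map_self_maps_eval_apply)
  qed
  have top: "topspace (subtopology ?TD ?K) = ?K"
    using topspace_operator_topology[of ?D \<S>] by (simp only: operator_topology_def)
  have AX: "restrict U X = ?\<rho> (restrict U ?D)" for U :: "'k functional \<Rightarrow> 'k functional"
    using X by (auto simp: fun_eq_iff)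
  have image: "?\<rho> ` ?K = closure_on \<S> X"
  proof
    have "?K = subtopology ?TD ?K closure_of ((\<lambda>R. restrict R ?D) ` \<S>)"
    proof -
      have "(\<lambda>R. restrict R ?D) ` \<S> \<subseteq> ?K"
        using restrict_in_operator_closure[OF _ inv] by blast
      then show ?thesis
        by (simp add: closure_of_subtopology Int_absorb1) (simp add: operator_closure_def)
    qed
    then have "?\<rho> ` ?K \<subseteq> ?TX closure_of (?\<rho> ` (\<lambda>R. restrict R ?D) ` \<S>)"
      using continuous_map_image_closure_subset[OF cont] by metis
    also have "?\<rho> ` (\<lambda>R. restrict R ?D) ` \<S> = ?\<rho> ` \<S>"
      unfolding image_image by (intro image_cong refl AX[symmetric])
    finally show "?\<rho> ` ?K \<subseteq> closure_on \<S> X" by (simp only: operator_closure_def)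
    have "compactin ?TD ?K" by (rule compactin_operator_closure) (erule inv, erule contr)
    then have "compactin (subtopology ?TD ?K) ?K" by (simp add: compactin_subtopology)
    from image_compactin[OF this cont] have "closedin ?TX (?\<rho> ` ?K)"
      by (rule compactin_imp_closedin[OF Hausdorff_space_self_maps])
    moreover have "?\<rho> ` \<S> \<subseteq> ?\<rho> ` ?K"
    proof (rule image_subsetI)
      fix U assume "U \<in> \<S>"
      then show "?\<rho> U \<in> ?\<rho> ` ?K"
        using restrict_in_operator_closure[OF _ inv] by (subst AX) (rule imageI)
    qed
    ultimately show "closure_on \<S> X \<subseteq> ?\<rho> ` ?K"
      unfolding operator_closure_def by (intro closure_of_minimal)
  qed
  have hom: "restrict (compose ?D R Q) X = compose X (restrict R X) (restrict Q X)"
    if "Q \<in> ?K" for R Q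
    using X_inv[OF that] X by (auto simp: compose_def fun_eq_iff Pi_iff)
  have "continuous_map (operator_topology ?D ?K) (operator_topology X (closure_on \<S> X)) ?\<rho>"
    using cont image top by (auto simp: operator_topology_def continuous_map_in_subtopology)
  moreover have "right_topological_semigroup (operator_topology ?D ?K) (compose ?D)"
    by (rule right_topological_semigroup_operator_closure[OF inv pre comp])
  moreover have "right_topological_semigroup (operator_topology X (closure_on \<S> X)) (compose X)"
    by (rule right_topological_semigroup_operator_closure[OF inv_X pre comp])
  ultimately show ?thesis
    unfolding rts_epimorphism_def rts_homomorphism_def topspace_operator_topology
    by (intro conjI ballI hom image)
qed

section \<open>Dunford--Schwartz operators and their adjoints\<close>

text \<open>Operators on \<open>C(K)\<close> that are contractive for the supremum norm and for the norm of \<open>L\<^sup>1(M)\<close>. The third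
clause is complex homogeneity, which the real Banach space structure of \<open>C(K)\<close> does not express.\<close>

definition dunford_schwartz ::
  "'k::topological_space measure \<Rightarrow> (('k \<Rightarrow>\<^sub>C complex) \<Rightarrow>\<^sub>L ('k \<Rightarrow>\<^sub>C complex)) \<Rightarrow> bool" where
  "dunford_schwartz M V \<longleftrightarrow> norm V \<le> 1 \<and>
     (\<forall>f. (LINT x|M. cmod (apply_bcontfun (blinfun_apply V f) x)) \<le> (LINT x|M. cmod (apply_bcontfun f x))) \<and>
     (\<forall>c f g. (\<forall>x. apply_bcontfun g x = c * apply_bcontfun f x) \<longrightarrow>
        (\<forall>x. apply_bcontfun (blinfun_apply V g) x = c * apply_bcontfun (blinfun_apply V f) x))"

definition dunford_schwartz_duals ::
  "'k::topological_space measure \<Rightarrow> ('k functional \<Rightarrow>\<^sub>L 'k functional) set" where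
  "dunford_schwartz_duals M = {W. \<exists>V. dunford_schwartz M V \<and> (\<forall>\<phi>. blinfun_apply W \<phi> = \<phi> o\<^sub>L V)}"

lemma dunford_schwartz_dual_dual_C:
  assumes W: "W \<in> dunford_schwartz_duals M" and \<phi>: "\<phi> \<in> dual_C"
  shows "blinfun_apply W \<phi> \<in> dual_C"
proof -
  obtain V where V: "dunford_schwartz M V" "\<And>\<phi>. blinfun_apply W \<phi> = \<phi> o\<^sub>L V"
    using W unfolding dunford_schwartz_duals_def by blast
  show ?thesis unfolding dual_C_def V(2)
  proof (intro CollectI allI impI)
    fix c and f g :: "'a \<Rightarrow>\<^sub>C complex" assume "\<forall>x. apply_bcontfun g x = c * apply_bcontfun f x"
    then have "\<forall>x. apply_bcontfun (blinfun_apply V g) x = c * apply_bcontfun (blinfun_apply V f) x"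
      using V(1) unfolding dunford_schwartz_def by blast
    then show "blinfun_apply (\<phi> o\<^sub>L V) g = c * blinfun_apply (\<phi> o\<^sub>L V) f"
      using \<phi> by (simp add: dual_C_def)
  qed
qed

lemma dunford_schwartz_dual_contraction:
  assumes "W \<in> dunford_schwartz_duals M"
  shows "norm (blinfun_apply W \<phi>) \<le> norm \<phi>"
proof -
  obtain V where V: "norm V \<le> 1" "blinfun_apply W \<phi> = \<phi> o\<^sub>L V"
    using assms unfolding dunford_schwartz_duals_def dunford_schwartz_def by blast
  have "norm (\<phi> o\<^sub>L V) \<le> norm \<phi> * norm V" by (rule norm_blinfun_compose)
  also have "\<dots> \<le> norm \<phi> * 1" by (intro mult_left_mono V) simp
  finally show ?thesis by (simp add: V(2))
qed

lemma (in compact_regular_probability) convex_dunford_schwartz_duals: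
  "convex (dunford_schwartz_duals M)"
proof (rule convexI)
  fix W1 W2 and u v :: real
  assume W: "W1 \<in> dunford_schwartz_duals M" "W2 \<in> dunford_schwartz_duals M" and uv: "0 \<le> u" "0 \<le> v" "u + v = 1"
  obtain V1 V2 where V: "dunford_schwartz M V1" "dunford_schwartz M V2"
    and WV: "\<And>\<phi>. blinfun_apply W1 \<phi> = \<phi> o\<^sub>L V1" "\<And>\<phi>. blinfun_apply W2 \<phi> = \<phi> o\<^sub>L V2"
    using W unfolding dunford_schwartz_duals_def by blast
  let ?V = "u *\<^sub>R V1 + v *\<^sub>R V2"
  have ap: "apply_bcontfun (blinfun_apply ?V f) x
      = u *\<^sub>R apply_bcontfun (blinfun_apply V1 f) x + v *\<^sub>R apply_bcontfun (blinfun_apply V2 f) x" for f x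
    by (simp add: blinfun.add_left blinfun.scaleR_left scaleR_bcontfun.rep_eq)
  have "dunford_schwartz M ?V" unfolding dunford_schwartz_def
  proof (intro conjI allI impI)
    have "norm ?V \<le> u * norm V1 + v * norm V2"
      using uv by (intro norm_triangle_le) simp
    also have "\<dots> \<le> u * 1 + v * 1"
      using V uv by (intro add_mono mult_left_mono) (auto simp: dunford_schwartz_def)
    finally show "norm ?V \<le> 1" using uv by simp
    fix f
    have "(LINT x|M. cmod (apply_bcontfun (blinfun_apply ?V f) x))
       \<le> (LINT x|M. u * cmod (apply_bcontfun (blinfun_apply V1 f) x) + v * cmod (apply_bcontfun (blinfun_apply V2 f) x))"
    proof (rule integral_mono)
      show "cmod (apply_bcontfun (blinfun_apply ?V f) x)
        \<le> u * cmod (apply_bcontfun (blinfun_apply V1 f) x) + v * cmod (apply_bcontfun (blinfun_apply V2 f) x)" for x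
        unfolding ap using uv by (intro norm_triangle_le) simp
    qed (intro integrable_norm integrable_apply_bcontfun Bochner_Integration.integrable_add integrable_mult_right)+
    also have "\<dots> = u * (LINT x|M. cmod (apply_bcontfun (blinfun_apply V1 f) x))
        + v * (LINT x|M. cmod (apply_bcontfun (blinfun_apply V2 f) x))"
      by (subst Bochner_Integration.integral_add) auto
    also have "\<dots> \<le> u * (LINT x|M. cmod (apply_bcontfun f x)) + v * (LINT x|M. cmod (apply_bcontfun f x))"
      using V uv by (intro add_mono mult_left_mono) (auto simp: dunford_schwartz_def)
    also have "\<dots> = (LINT x|M. cmod (apply_bcontfun f x))"
      using uv(3) by (simp add: distrib_right[symmetric])
    finally show "(LINT x|M. cmod (apply_bcontfun (blinfun_apply ?V f) x)) \<le> (LINT x|M. cmod (apply_bcontfun f x))" .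
  next
    fix c and f g :: "'k \<Rightarrow>\<^sub>C complex" and x assume fg: "\<forall>x. apply_bcontfun g x = c * apply_bcontfun f x"
    have "apply_bcontfun (blinfun_apply V1 g) x = c * apply_bcontfun (blinfun_apply V1 f) x"
      "apply_bcontfun (blinfun_apply V2 g) x = c * apply_bcontfun (blinfun_apply V2 f) x"
      using V fg unfolding dunford_schwartz_def by blast+
    then show "apply_bcontfun (blinfun_apply ?V g) x = c * apply_bcontfun (blinfun_apply ?V f) x"
      unfolding ap by (simp add: scaleR_conv_of_real algebra_simps)
  qed
  moreover have "blinfun_apply (u *\<^sub>R W1 + v *\<^sub>R W2) \<phi> = \<phi> o\<^sub>L ?V" for \<phi>
    by (rule blinfun_eqI) (simp add: blinfun.add_left blinfun.scaleR_left WV blinfun.add_right blinfun.scaleR_right)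
  ultimately show "u *\<^sub>R W1 + v *\<^sub>R W2 \<in> dunford_schwartz_duals M"
    unfolding dunford_schwartz_duals_def by blast
qed

text \<open>The contraction property for \<open>L\<^sup>1(M)\<close> is the invariance of \<open>M\<close>, applied to the continuous
function \<open>\<bar>f\<bar>\<close>.\<close>

lemma (in compact_regular_probability) koopman_dual_dunford_schwartz:
  assumes cont: "continuous_on UNIV (act s)" and inv: "invariant_measure act M"
  shows "koopman_dual act s \<in> dunford_schwartz_duals M"
proof -
  note ap = koopman_apply[where act = act, OF cont]
  have "dunford_schwartz M (koopman act s)" unfolding dunford_schwartz_def
  proof (intro conjI allI impI)
    show "norm (koopman act s) \<le> 1"
    proof (rule norm_blinfun_bound)
      show "norm (blinfun_apply (koopman act s) f) \<le> 1 * norm f" for f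
        by (rule norm_bound) (simp add: ap norm_bounded)
    qed simp
    fix f :: "'k \<Rightarrow>\<^sub>C complex"
    have "(\<lambda>x. complex_of_real (cmod (apply_bcontfun f x))) \<in> bcontfun"
      by (rule bcontfun_normI[where b = "norm f"]) (auto intro!: continuous_intros norm_bounded)
    then have a: "apply_bcontfun (Bcontfun (\<lambda>x. complex_of_real (cmod (apply_bcontfun f x)))) x
        = complex_of_real (cmod (apply_bcontfun f x))" for x
      by (simp add: Bcontfun_inverse)
    let ?f = "Bcontfun (\<lambda>x. complex_of_real (cmod (apply_bcontfun f x)))"
    have "blinfun_apply (functional_of_measure M) (blinfun_apply (koopman act s) ?f)
        = blinfun_apply (functional_of_measure M) ?f"
      using inv unfolding invariant_measure_def koopman_dual_apply
      by (metis blinfun_compose.rep_eq comp_apply)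
    then have "(LINT x|M. complex_of_real (cmod (apply_bcontfun f (act s x))))
        = (LINT x|M. complex_of_real (cmod (apply_bcontfun f x)))"
      unfolding functional_of_measure_apply[OF regular] ap a .
    then show "(LINT x|M. cmod (apply_bcontfun (blinfun_apply (koopman act s) f) x)) 
        \<le> (LINT x|M. cmod (apply_bcontfun f x))"
      unfolding ap by (simp only: integral_complex_of_real of_real_eq_iff)
  qed (simp add: ap)
  then show ?thesis unfolding dunford_schwartz_duals_def
    using koopman_dual_apply[of act s] by blast
qed

text \<open>For fixed \<open>V\<close>, the operators whose product with \<open>V\<close> lies in the hull form a convex set, because
composition is bilinear; the same holds on the other side.\<close>

lemma convex_hull_compose_closed:
  fixes H :: "('a::real_normed_vector \<Rightarrow>\<^sub>L 'a) set"
  assumes H: "\<And>U V. U \<in> H \<Longrightarrow> V \<in> H \<Longrightarrow> U o\<^sub>L V \<in> H"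
    and U: "U \<in> convex hull H" and V: "V \<in> convex hull H"
  shows "U o\<^sub>L V \<in> convex hull H"
proof -
  have right: "linear (\<lambda>W. U o\<^sub>L W)" and left: "linear (\<lambda>W. W o\<^sub>L U)" for U :: "'a \<Rightarrow>\<^sub>L 'a"
    using bounded_bilinear.bounded_linear_right[OF bounded_bilinear_blinfun_compose]
      bounded_bilinear.bounded_linear_left[OF bounded_bilinear_blinfun_compose]
    by (auto intro: bounded_linear.linear)
  have 1: "W o\<^sub>L V \<in> convex hull H" if W: "W \<in> H" for W
  proof -
    have "convex hull H \<subseteq> (\<lambda>V. W o\<^sub>L V) -` (convex hull H)"
      by (rule hull_minimal) (auto intro!: hull_inc H W convex_linear_vimage[OF right])
    with V show ?thesis by blast
  qed
  have "convex hull H \<subseteq> (\<lambda>W. W o\<^sub>L V) -` (convex hull H)"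
    by (rule hull_minimal) (auto intro!: 1 convex_linear_vimage[OF left])
  with U show ?thesis by blast
qed

lemma rts_epimorphism_restrict_dunford_schwartz:
  fixes M :: "'k::topological_space measure"
  assumes H: "H \<subseteq> dunford_schwartz_duals M"
    and comp: "\<And>U V. U \<in> H \<Longrightarrow> V \<in> H \<Longrightarrow> U o\<^sub>L V \<in> H"
    and X: "X \<subseteq> dual_C"
    and X_inv: "\<And>R. R \<in> closure_on (blinfun_apply ` H) dual_C \<Longrightarrow> R \<in> X \<rightarrow> X"
  shows "rts_epimorphism
           (operator_topology dual_C (closure_on (blinfun_apply ` H) dual_C)) (compose dual_C)
           (operator_topology X (closure_on (blinfun_apply ` H) X)) (compose X) (\<lambda>R. restrict R X)"
proof (rule rts_epimorphism_restrict[OF _ _ _ _ X X_inv])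
  fix U assume "U \<in> blinfun_apply ` H"
  then obtain W where W: "W \<in> H" "U = blinfun_apply W" by blast
  then have W': "W \<in> dunford_schwartz_duals M" using H by blast
  show "U \<in> dual_C \<rightarrow> dual_C" using dunford_schwartz_dual_dual_C[OF W'] W(2) by simp
  show "norm (U \<phi>) \<le> norm \<phi>" for \<phi> using dunford_schwartz_dual_contraction[OF W'] W(2) by simp
  show "has_preadjoint U"
    using W' unfolding dunford_schwartz_duals_def has_preadjoint_def W(2) by fastforce
  fix U' assume "U' \<in> blinfun_apply ` H"
  then obtain W' where W': "W' \<in> H" "U' = blinfun_apply W'" by blast
  have "U \<circ> U' = blinfun_apply (W o\<^sub>L W')" by (simp add: W(2) W'(2) blinfun_compose.rep_eq)
  then show "U \<circ> U' \<in> blinfun_apply ` H" using comp[OF W(1) W'(1)] by simp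
qed

section \<open>Invariance of \<open>L\<^sup>1\<close> and \<open>\<ell>\<^sup>1\<close> under the closure\<close>

text \<open>Approximating \<open>\<phi>\<close> in norm by some \<open>\<psi>\<close> with bounded density, both the bound that expresses bounded
density of \<open>R \<psi>\<close> and the estimate \<open>\<parallel>R \<phi> - R \<psi>\<parallel> \<le> \<parallel>\<phi> - \<psi>\<parallel>\<close> are closed conditions on \<open>R\<close>. The first of
them needs the contraction property on \<open>L\<^sup>1(M)\<close>, the second the one on \<open>C(K)\<close>.\<close>

lemma (in compact_regular_probability) operator_closure_L1_space:
  assumes H: "H \<subseteq> dunford_schwartz_duals M"
    and R: "R \<in> closure_on (blinfun_apply ` H) dual_C"
  shows "R \<in> L1_space M \<rightarrow> L1_space M"
proof
  let ?T = "self_map_topology dual_C UNIV (blinfun_apply :: 'k functional \<Rightarrow> _)"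
  fix \<phi> assume \<phi>: "\<phi> \<in> L1_space M"
  then have \<phi>D: "\<phi> \<in> dual_C" by (simp add: L1_space_def)
  have RD: "R \<psi> \<in> dual_C" if "\<psi> \<in> dual_C" for \<psi>
    using R that operator_closure_subset by blast
  show "R \<phi> \<in> L1_space M"
  proof (rule approx_imp_L1_space[OF RD[OF \<phi>D]])
    fix e :: real assume "e > 0"
    then obtain \<psi> where \<psi>: "bounded_density_functional \<psi>" "norm (\<phi> - \<psi>) \<le> e"
      using L1_space_imp_approx[OF \<phi>] by blast
    obtain c where \<psi>D: "\<psi> \<in> dual_C" and c: "c \<ge> 0"
        "\<And>f. cmod (blinfun_apply \<psi> f) \<le> c * (LINT x|M. cmod (apply_bcontfun f x))"
      using \<psi>(1) unfolding bounded_density_functional_def by blast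
    have pre: "\<exists>V. dunford_schwartz M V \<and> (\<forall>\<phi>. U \<phi> = \<phi> o\<^sub>L V)" if "U \<in> blinfun_apply ` H" for U
      using that H unfolding dunford_schwartz_duals_def by blast
    have "cmod (blinfun_apply (R \<psi>) f) \<le> c * (LINT x|M. cmod (apply_bcontfun f x))" for f
    proof -
      let ?Z = "cball (0::complex) (c * (LINT x|M. cmod (apply_bcontfun f x)))"
      have "blinfun_apply (R \<psi>) f \<in> ?Z"
      proof (rule operator_closure_closed_condition[OF R continuous_map_self_maps_eval_apply[OF \<psi>D]])
        fix U assume "U \<in> blinfun_apply ` H"
        then obtain V where V: "dunford_schwartz M V" "U \<psi> = \<psi> o\<^sub>L V" using pre by blast
        have "cmod (blinfun_apply \<psi> (blinfun_apply V f)) 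
            \<le> c * (LINT x|M. cmod (apply_bcontfun (blinfun_apply V f) x))" by (rule c(2))
        also have "\<dots> \<le> c * (LINT x|M. cmod (apply_bcontfun f x))"
          by (rule mult_left_mono[OF _ c(1)]) (use V(1) in \<open>simp add: dunford_schwartz_def\<close>)
        finally show "blinfun_apply (restrict U dual_C \<psi>) f \<in> ?Z"
          using \<psi>D V(2) by simp
      qed simp
      then show ?thesis by simp
    qed
    then have "bounded_density_functional (R \<psi>)"
      unfolding bounded_density_functional_def using RD[OF \<psi>D] c(1) by blast
    moreover have "norm (R \<phi> - R \<psi>) \<le> e"
    proof (rule norm_blinfun_bound)
      fix f
      have cont: "continuous_map ?T euclidean (\<lambda>R. blinfun_apply (R \<phi>) f - blinfun_apply (R \<psi>) f)"
        by (intro continuous_map_diff continuous_map_self_maps_eval_apply \<phi>D \<psi>D)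
      have "blinfun_apply (R \<phi>) f - blinfun_apply (R \<psi>) f \<in> cball 0 (e * norm f)"
      proof (rule operator_closure_closed_condition[OF R cont])
        fix U assume "U \<in> blinfun_apply ` H"
        then obtain W where W: "W \<in> dunford_schwartz_duals M" "U = blinfun_apply W" using H by blast
        have "norm (U \<phi> - U \<psi>) \<le> norm (\<phi> - \<psi>)"
          using dunford_schwartz_dual_contraction[OF W(1), of "\<phi> - \<psi>"] by (simp add: W(2) blinfun.diff_right)
        then have "norm (U \<phi> - U \<psi>) \<le> e" using \<psi>(2) by simp
        then have "cmod (blinfun_apply (U \<phi> - U \<psi>) f) \<le> e * norm f"
          using norm_blinfun[of "U \<phi> - U \<psi>" f] mult_right_mono[of "norm (U \<phi> - U \<psi>)" e "norm f"] by simp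
        then show "blinfun_apply (restrict U dual_C \<phi>) f - blinfun_apply (restrict U dual_C \<psi>) f \<in> cball 0 (e * norm f)"
          using \<phi>D \<psi>D by (simp add: blinfun.diff_left)
      qed simp
      then show "cmod (blinfun_apply (R \<phi> - R \<psi>) f) \<le> e * norm f" by (simp add: blinfun.diff_left)
    qed (use \<open>e > 0\<close> in simp)
    ultimately show "\<exists>\<psi>. bounded_density_functional \<psi> \<and> norm (R \<phi> - \<psi>) \<le> e" by blast
  qed
qed

definition dirac_functional :: "'k::topological_space \<Rightarrow> 'k functional" where
  "dirac_functional x = Blinfun (\<lambda>f. apply_bcontfun f x)"

lemma dirac_functional_apply [simp]: "blinfun_apply (dirac_functional x) f = apply_bcontfun f x"
proof -
  have "bounded_linear (\<lambda>f :: 'a \<Rightarrow>\<^sub>C complex. apply_bcontfun f x)"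
    by (rule bounded_linear_intro[where K = 1]) (auto simp: scaleR_bcontfun.rep_eq norm_bounded)
  then show ?thesis by (simp add: dirac_functional_def bounded_linear_Blinfun_apply)
qed

lemma dirac_functional_dual_C: "dirac_functional x \<in> dual_C"
  by (simp add: dual_C_def)

text \<open>The point evaluations are a continuous image of the compact space \<open>K\<close>.\<close>

lemma closedin_dirac_functionals:
  assumes "compact (UNIV :: 'k::topological_space set)"
  shows "closedin (weak_star dual_C) (range (dirac_functional :: 'k \<Rightarrow> _))"
proof (rule compactin_imp_closedin[OF Hausdorff_space_weak_star])
  have "continuous_map euclidean (weak_star dual_C) (dirac_functional :: 'k \<Rightarrow> _)"
    by (simp add: continuous_map_weak_star_iff dirac_functional_dual_C)
  then show "compactin (weak_star dual_C) (range (dirac_functional :: 'k \<Rightarrow> _))"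
    using assms by (intro image_compactin[of euclidean]) simp_all
qed

text \<open>Compactness of the set of point evaluations yields the map \<open>\<theta>\<close> with \<open>R \<delta>\<^sub>x = \<delta>\<^bsub>\<theta>(x)\<^esub>\<close>. As a weak* limit, \<open>R\<close>
need not commute with infinite sums for a formal reason; the estimate \<open>tail\<close> supplies this,
since its bound does not depend on the generator. The image of \<open>\<phi>\<close> is then the discrete measure
whose weight at \<open>y\<close> is the sum of the weights over the fibre of \<open>\<theta>\<close> at \<open>y\<close>.\<close>

lemma operator_closure_l1_space:
  fixes act :: "'s \<Rightarrow> 'k::t2_space \<Rightarrow> 'k"
  assumes compact: "compact (UNIV :: 'k set)"
    and cont: "\<And>s. continuous_on UNIV (act s)"
    and R: "R \<in> closure_on (koopman_semigroup act) dual_C"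
  shows "R \<in> l1_space \<rightarrow> l1_space"
proof
  let ?T = "self_map_topology dual_C UNIV (blinfun_apply :: 'k functional \<Rightarrow> _)"
  note ap = koopman_apply[where act = act, OF cont]
  have RD: "R \<psi> \<in> dual_C" if "\<psi> \<in> dual_C" for \<psi>
    using R that operator_closure_subset by blast
  have "R (dirac_functional x) \<in> range dirac_functional" for x
  proof (rule operator_closure_closed_condition[OF R
        continuous_map_self_maps_eval[OF dirac_functional_dual_C] closedin_dirac_functionals[OF compact]])
    fix U assume "U \<in> koopman_semigroup act"
    then obtain s where s: "U = blinfun_apply (koopman_dual act s)" by blast
    have "U (dirac_functional x) = dirac_functional (act s x)"
      by (rule blinfun_eqI) (simp add: s koopman_dual_apply ap)
    then show "restrict U dual_C (dirac_functional x) \<in> range dirac_functional"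
      by (simp add: dirac_functional_dual_C)
  qed
  then have "\<forall>x. \<exists>y. R (dirac_functional x) = dirac_functional y" by blast
  then obtain \<theta> where \<theta>: "\<And>x. R (dirac_functional x) = dirac_functional (\<theta> x)" by metis
  fix \<phi> :: "'k functional" assume "\<phi> \<in> l1_space"
  then obtain a where \<phi>D: "\<phi> \<in> dual_C" and a: "(\<lambda>x. cmod (a x)) summable_on UNIV"
    and rep: "\<And>f. blinfun_apply \<phi> f = (\<Sum>\<^sub>\<infinity>x. a x * apply_bcontfun f x)"
    unfolding l1_space_def by blast
  have abs: "(\<lambda>x. norm (a x * apply_bcontfun f (g x))) summable_on A" for f A and g :: "'k \<Rightarrow> 'k"
  proof (rule Infinite_Sum.abs_summable_on_comparison_test')
    show "(\<lambda>x. cmod (a x) * norm f) summable_on A"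
      by (intro summable_on_cmult_left summable_on_subset_banach[OF a]) simp
    show "norm (a x * apply_bcontfun f (g x)) \<le> cmod (a x) * norm f" for x
      by (simp add: norm_mult mult_left_mono norm_bounded)
  qed
  \<comment> \<open>The mass of \<open>\<phi>\<close> outside the finite set \<open>F\<close>.\<close>
  define t where "t F = (\<Sum>\<^sub>\<infinity>x\<in>UNIV - F. cmod (a x))" for F
  have tail: "cmod (blinfun_apply (R \<phi>) f - (\<Sum>x\<in>F. a x * apply_bcontfun f (\<theta> x))) \<le> t F * norm f"
    if F: "finite F" for F f
  proof -
    have "continuous_map ?T euclidean (\<lambda>R. a x * blinfun_apply (R (dirac_functional x)) f)" for x
    proof -
      have "continuous_map euclidean euclidean (\<lambda>z. a x * z)"
        by (simp add: continuous_intros)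
      from continuous_map_compose[OF continuous_map_self_maps_eval_apply[OF dirac_functional_dual_C] this]
      show ?thesis by (simp add: o_def)
    qed
    then have "continuous_map ?T euclidean
        (\<lambda>R. blinfun_apply (R \<phi>) f - (\<Sum>x\<in>F. a x * blinfun_apply (R (dirac_functional x)) f))"
      by (intro continuous_map_diff continuous_map_sum continuous_map_self_maps_eval_apply \<phi>D F)
    then have "blinfun_apply (R \<phi>) f - (\<Sum>x\<in>F. a x * blinfun_apply (R (dirac_functional x)) f)
        \<in> cball 0 (t F * norm f)"
    proof (rule operator_closure_closed_condition[OF R])
      fix U assume "U \<in> koopman_semigroup act"
      then obtain s where s: "U = blinfun_apply (koopman_dual act s)" by blast
      have U: "blinfun_apply (U \<psi>) f = blinfun_apply \<psi> (blinfun_apply (koopman act s) f)" for \<psi>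
        by (simp add: s koopman_dual_apply)
      have sm: "(\<lambda>x. a x * apply_bcontfun f (act s x)) summable_on A" for A
        by (rule abs_summable_summable[OF abs])
      have "blinfun_apply (U \<phi>) f - (\<Sum>x\<in>F. a x * apply_bcontfun f (act s x))
         = (\<Sum>\<^sub>\<infinity>x\<in>UNIV - F. a x * apply_bcontfun f (act s x))"
        using infsum_Diff[OF sm[of UNIV] sm[of F]] F by (simp add: U rep ap)
      moreover have "cmod \<dots> \<le> (\<Sum>\<^sub>\<infinity>x\<in>UNIV - F. cmod (a x * apply_bcontfun f (act s x)))"
        by (rule norm_infsum_bound[OF abs])
      moreover have "\<dots> \<le> (\<Sum>\<^sub>\<infinity>x\<in>UNIV - F. cmod (a x) * norm f)"
      proof (rule infsum_mono[OF abs])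
        show "(\<lambda>x. cmod (a x) * norm f) summable_on UNIV - F"
          by (intro summable_on_cmult_left summable_on_subset_banach[OF a]) simp
      qed (simp add: norm_mult mult_left_mono norm_bounded)
      moreover have "\<dots> = t F * norm f"
        unfolding t_def by (intro infsum_cmult_left summable_on_subset_banach[OF a]) simp
      ultimately show "blinfun_apply (restrict U dual_C \<phi>) f -
          (\<Sum>x\<in>F. a x * blinfun_apply (restrict U dual_C (dirac_functional x)) f) \<in> cball 0 (t F * norm f)"
        using \<phi>D by (simp add: U ap dirac_functional_dual_C)
    qed simp
    then show ?thesis by (simp add: \<theta>)
  qed
  have R\<phi>: "blinfun_apply (R \<phi>) f = (\<Sum>\<^sub>\<infinity>x. a x * apply_bcontfun f (\<theta> x))" for f
  proof (rule infsumI[symmetric])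
    have "((\<lambda>F. (\<Sum>\<^sub>\<infinity>x. cmod (a x)) - (\<Sum>x\<in>F. cmod (a x))) \<longlongrightarrow> 0) (finite_subsets_at_top UNIV)"
      using tendsto_diff[OF tendsto_const[of "\<Sum>\<^sub>\<infinity>x. cmod (a x)"] infsum_tendsto[OF a]] by simp
    moreover have "\<forall>\<^sub>F F in finite_subsets_at_top UNIV. (\<Sum>\<^sub>\<infinity>x. cmod (a x)) - (\<Sum>x\<in>F. cmod (a x)) = t F"
      by (rule eventually_finite_subsets_at_top_weakI)
        (simp add: t_def infsum_Diff[OF a summable_on_finite])
    ultimately have "(t \<longlongrightarrow> 0) (finite_subsets_at_top UNIV)"
      by (rule Lim_transform_eventually)
    then have t0: "((\<lambda>F. t F * norm f) \<longlongrightarrow> 0) (finite_subsets_at_top UNIV)"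
      using tendsto_mult_left_zero by blast
    have "((\<lambda>F. blinfun_apply (R \<phi>) f - (\<Sum>x\<in>F. a x * apply_bcontfun f (\<theta> x))) \<longlongrightarrow> 0) (finite_subsets_at_top UNIV)"
      by (rule Lim_null_comparison[OF _ t0])
        (rule eventually_finite_subsets_at_top_weakI, rule tail)
    from tendsto_diff[OF tendsto_const[of "blinfun_apply (R \<phi>) f"] this]
    show "((\<lambda>x. a x * apply_bcontfun f (\<theta> x)) has_sum blinfun_apply (R \<phi>) f) UNIV"
      by (simp add: has_sum_def)
  qed
  define b where "b y = (\<Sum>\<^sub>\<infinity>x\<in>\<theta> -` {y}. a x)" for y
  \<comment> \<open>The sum over \<open>x\<close> is regrouped along the fibres of \<open>\<theta>\<close>.\<close>
  have bij: "bij_betw (\<lambda>x. (\<theta> x, x)) UNIV (Sigma UNIV (\<lambda>y. \<theta> -` {y}))"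
    by (rule bij_betw_byWitness[where f' = snd]) auto
  have fibres: "(\<lambda>p. norm ((\<lambda>(y, x). a x * apply_bcontfun f y) p)) summable_on Sigma UNIV (\<lambda>y. \<theta> -` {y})" for f
    by (rule summable_on_reindex_bij_betw[OF bij, THEN iffD1]) (use abs[of f \<theta> UNIV] in simp)
  have "(\<lambda>y. cmod (b y)) summable_on UNIV"
  proof -
    have "(\<lambda>p. norm ((\<lambda>(y, x). a x) p)) summable_on Sigma UNIV (\<lambda>y. \<theta> -` {y})"
      by (rule summable_on_reindex_bij_betw[OF bij, THEN iffD1]) (use a in simp)
    then have 1: "(\<lambda>x. norm (a x)) summable_on \<theta> -` {y}"
      and 2: "(\<lambda>y. norm (\<Sum>\<^sub>\<infinity>x\<in>\<theta> -` {y}. cmod (a x))) summable_on UNIV" for y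
      unfolding Infinite_Sum.abs_summable_on_Sigma_iff by auto
    show ?thesis
      by (rule Infinite_Sum.abs_summable_on_comparison_test[OF 2])
        (unfold b_def real_norm_def, rule order_trans[OF norm_infsum_bound[OF 1] abs_ge_self])
  qed
  moreover have "blinfun_apply (R \<phi>) f = (\<Sum>\<^sub>\<infinity>y. b y * apply_bcontfun f y)" for f
  proof -
    have "blinfun_apply (R \<phi>) f = (\<Sum>\<^sub>\<infinity>(y, x)\<in>Sigma UNIV (\<lambda>y. \<theta> -` {y}). a x * apply_bcontfun f y)"
      unfolding R\<phi> by (subst infsum_reindex_bij_betw[OF bij, symmetric]) simp
    also have "\<dots> = (\<Sum>\<^sub>\<infinity>y. \<Sum>\<^sub>\<infinity>x\<in>\<theta> -` {y}. a x * apply_bcontfun f y)"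
      by (subst infsum_Sigma_banach[OF abs_summable_summable[OF fibres], symmetric]) simp
    also have "\<dots> = (\<Sum>\<^sub>\<infinity>y. b y * apply_bcontfun f y)"
    proof (rule infsum_cong)
      fix y
      show "(\<Sum>\<^sub>\<infinity>x\<in>\<theta> -` {y}. a x * apply_bcontfun f y) = b y * apply_bcontfun f y"
        unfolding b_def
        by (rule infsum_cmult_left, rule abs_summable_summable, rule summable_on_subset_banach[OF a]) simp
    qed
    finally show ?thesis .
  qed
  ultimately show "R \<phi> \<in> l1_space"
    unfolding l1_space_def using RD[OF \<phi>D] by (intro CollectI conjI exI[of _ b] allI)
qed

theorem proposition3p8:
  fixes act :: "'s::{topological_space,semigroup_mult} \<Rightarrow> 'k::t2_space \<Rightarrow> 'k"
    and \<mu> :: "'k measure"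
  assumes "topological_dynamical_system act"
    and "regular_borel_probability \<mu>"
    and "invariant_measure act \<mu>"
  shows "rts_epimorphism
           (operator_topology dual_C (koehler_semigroup act)) (compose dual_C)
           (operator_topology l1_space (ellis_semigroup act)) (compose l1_space)
           (\<lambda>R. restrict R l1_space) \<and>
         rts_epimorphism
           (operator_topology dual_C (koehler_semigroup act)) (compose dual_C)
           (operator_topology (L1_space \<mu>) (jacobs_semigroup act \<mu>)) (compose (L1_space \<mu>))
           (\<lambda>R. restrict R (L1_space \<mu>)) \<and>
         rts_epimorphism
           (operator_topology dual_C (convex_koehler_semigroup act)) (compose dual_C)
           (operator_topology (L1_space \<mu>) (convex_jacobs_semigroup act \<mu>)) (compose (L1_space \<mu>))
           (\<lambda>R. restrict R (L1_space \<mu>)) \<and>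
         koehler_semigroup act \<subseteq> convex_koehler_semigroup act \<and>
         jacobs_semigroup act \<mu> \<subseteq> convex_jacobs_semigroup act \<mu>"
proof -
  let ?H = "range (koopman_dual act)"
  have compact: "compact (UNIV :: 'k set)"
    using assms(1) by (simp add: topological_dynamical_system_def)
  interpret compact_regular_probability \<mu>
    by standard (fact assms(2), fact compact)
  note cont = continuous_on_act[OF assms(1)]
  have H: "?H \<subseteq> dunford_schwartz_duals \<mu>"
    using koopman_dual_dunford_schwartz[OF cont assms(3)] by blast
  have Hc: "convex hull ?H \<subseteq> dunford_schwartz_duals \<mu>"
    by (rule hull_minimal[where S = convex, OF H convex_dunford_schwartz_duals])
  have "koopman_dual act s o\<^sub>L koopman_dual act t = koopman_dual act (s * t)" for s t
  proof (intro blinfun_eqI)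
    fix \<phi> f
    have "blinfun_apply (koopman act t) (blinfun_apply (koopman act s) f) = blinfun_apply (koopman act (s * t)) f"
      using assms(1) by (intro bcontfun_eqI) (simp add: koopman_apply[where act = act, OF cont] topological_dynamical_system_def)
    then show "blinfun_apply (blinfun_apply (koopman_dual act s o\<^sub>L koopman_dual act t) \<phi>) f
        = blinfun_apply (blinfun_apply (koopman_dual act (s * t)) \<phi>) f"
      by (simp add: koopman_dual_apply)
  qed
  then have comp: "U o\<^sub>L V \<in> ?H" if "U \<in> ?H" "V \<in> ?H" for U V
    using that by auto
  have comp_c: "U o\<^sub>L V \<in> convex hull ?H" if "U \<in> convex hull ?H" "V \<in> convex hull ?H" for U V
    by (rule convex_hull_compose_closed[OF comp that])
  have l1: "l1_space \<subseteq> (dual_C :: 'k functional set)" and L1: "L1_space \<mu> \<subseteq> dual_C"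
    by (auto simp: l1_space_def L1_space_def)
  have sub: "closure_on (koopman_semigroup act) X \<subseteq> closure_on (convex_koopman_semigroup act) X" for X
    unfolding operator_closure_def by (intro closure_of_mono image_mono hull_subset)
  show ?thesis
    unfolding koehler_semigroup_def convex_koehler_semigroup_def ellis_semigroup_def
      jacobs_semigroup_def convex_jacobs_semigroup_def
  proof (intro conjI sub)
    show "rts_epimorphism
        (operator_topology dual_C (closure_on (koopman_semigroup act) dual_C)) (compose dual_C)
        (operator_topology l1_space (closure_on (koopman_semigroup act) l1_space)) (compose l1_space)
        (\<lambda>R. restrict R l1_space)"
      by (rule rts_epimorphism_restrict_dunford_schwartz[OF H _ l1])
        (erule (1) comp, erule operator_closure_l1_space[OF compact cont])
    show "rts_epimorphism
        (operator_topology dual_C (closure_on (koopman_semigroup act) dual_C)) (compose dual_C)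
        (operator_topology (L1_space \<mu>) (closure_on (koopman_semigroup act) (L1_space \<mu>)))
        (compose (L1_space \<mu>)) (\<lambda>R. restrict R (L1_space \<mu>))"
      by (rule rts_epimorphism_restrict_dunford_schwartz[OF H _ L1])
        (erule (1) comp, erule operator_closure_L1_space[OF H])
    show "rts_epimorphism
        (operator_topology dual_C (closure_on (convex_koopman_semigroup act) dual_C)) (compose dual_C)
        (operator_topology (L1_space \<mu>) (closure_on (convex_koopman_semigroup act) (L1_space \<mu>)))
        (compose (L1_space \<mu>)) (\<lambda>R. restrict R (L1_space \<mu>))"
      by (rule rts_epimorphism_restrict_dunford_schwartz[OF Hc _ L1])
        (erule (1) comp_c, erule operator_closure_L1_space[OF Hc])
  qed
qed

end
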